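(* Let $\mathbb{K}$ be a field and let $n,k,m\in\mathbb{N}$ be such that $n\geq 2$, $m\geq k\geq 3$ and $(n,k)\neq(2,3)$. Then for generic $F\in\mathcal{P}_{n,k}^{(m)}$, one has $x_1a\neq 0$ in $\bar A_F$ for every non-zero $a\in\bar A_F$.
   Context: $\mathbb{K}\langle x_1,\dots,x_n\rangle$ is the free associative unital algebra, graded by $\deg x_i=1$; $F_j$ denotes the homogeneous component of degree $j$ of $F$. $\mathbb{K}^{\rm cyc}\langle x_1,\dots,x_n\rangle$ is the subspace of cyclically invariant elements, i.e. elements fixed by the linear map sending $1\mapsto 1$ and $x_iu\mapsto ux_i$ for every monomial $u$ and every $i$; its elements are called potentials. For each $j$, the noncommutative derivative $\delta_{x_j}$ is the linear map on $\mathbb{K}\langle x_1,\dots,x_n\rangle$ with $\delta_{x_j}(x_jv)=v$ for every monomial $v$, and $\delta_{x_j}(u)=0$ for every monomial $u$ not starting with $x_j$. $\mathcal{P}_{n,k}^{(m)}=\{F\in\mathbb{K}^{\rm cyc}\langle x_1,\dots,x_n\rangle: F_j=0 \text{ for } j<k \text{ and for } j>m\}$, a finite dimensional vector space. The potential algebra of $F$ is $A_F=\mathbb{K}\langle x_1,\dots,x_n\rangle/I$, where $I$ is the two-sided ideal generated by $\delta_{x_1}F,\dots,\delta_{x_n}F$. For $j\in\mathbb{Z}_+$, let $J^{(j)}$ be the ideal generated by all monomials of degree strictly bigger than $j$. The completion of $I$ is $\bar I=\bigcap_{j}(I+J^{(j)})$, and the completion of $A_F$ is $\bar A_F=\mathbb{K}\langle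 x_1,\dots,x_n\rangle/\bar I$. "For generic $F$" in a finite dimensional vector space means: for all $F$ outside some countable union of proper algebraic subvarieties (zero sets of non-zero polynomial functions in the coefficients of $F$). *)

theory Defs
  imports
    "HOL-Algebra.QuotRing"
    "HOL-Library.Poly_Mapping"
    "HOL-Library.Countable_Set"
begin

text \<open>
  Monomials are words, that is, lists of letters; the letter \<open>i :: nat\<close> stands for the variable
  \<open>x\<^sub>i\<close>. Lists form a monoid under concatenation, written additively because the
  multiplication of \<open>Poly_Mapping\<close> is convolution over an additive monoid. Hence
  \<open>nat list \<Rightarrow>\<^sub>0 'k\<close> is the free associative unital algebra on the letters \<open>nat\<close>.
\<close>

instantiation list :: (type) monoid_add
begin

definition zero_list :: "'a list" where "zero_list = []"

definition plus_list :: "'a list \<Rightarrow> 'a list \<Rightarrow> 'a list" where "plus_list = append"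

instance
  by standard (simp_all add: zero_list_def plus_list_def)

end

type_synonym 'k ncpoly = "nat list \<Rightarrow>\<^sub>0 'k"

definition ncmonom :: "nat list \<Rightarrow> 'k::field ncpoly" where
  "ncmonom u = Poly_Mapping.single u 1"

definition words :: "nat \<Rightarrow> nat list set" where
  "words n = lists {1..n}"

definition free_algebra :: "nat \<Rightarrow> 'k::field ncpoly ring" where
  "free_algebra n =
    \<lparr>carrier = {f. Poly_Mapping.keys f \<subseteq> words n}, mult = (*), one = 1, zero = 0, add = (+)\<rparr>"

definition hom_component :: "nat \<Rightarrow> 'k::field ncpoly \<Rightarrow> 'k ncpoly" where
  "hom_component j f =
    (\<Sum>u | u \<in> Poly_Mapping.keys f \<and> length u = j. Poly_Mapping.single u (Poly_Mapping.lookup f u))"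

definition cyc_rotate :: "'k::field ncpoly \<Rightarrow> 'k ncpoly" where
  "cyc_rotate f =
    (\<Sum>u\<in>Poly_Mapping.keys f. Poly_Mapping.single (rotate1 u) (Poly_Mapping.lookup f u))"

definition nc_deriv :: "nat \<Rightarrow> 'k::field ncpoly \<Rightarrow> 'k ncpoly" where
  "nc_deriv j f =
    (\<Sum>u | u \<in> Poly_Mapping.keys f \<and> u \<noteq> [] \<and> hd u = j.
       Poly_Mapping.single (tl u) (Poly_Mapping.lookup f u))"

definition potentials :: "nat \<Rightarrow> 'k::field ncpoly set" where
  "potentials n = {F \<in> carrier (free_algebra n). cyc_rotate F = F}"

definition potential_space :: "nat \<Rightarrow> nat \<Rightarrow> nat \<Rightarrow> 'k::field ncpoly set" where
  "potential_space n k m = {F \<in> potentials n. \<forall>j. j < k \<or> j > m \<longrightarrow> hom_component j F = 0}"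

definition potential_ideal :: "nat \<Rightarrow> 'k::field ncpoly \<Rightarrow> 'k ncpoly set" where
  "potential_ideal n F = Idl\<^bsub>free_algebra n\<^esub> {nc_deriv j F | j. j \<in> {1..n}}"

definition degree_ideal :: "nat \<Rightarrow> nat \<Rightarrow> 'k::field ncpoly set" where
  "degree_ideal n j = Idl\<^bsub>free_algebra n\<^esub> {ncmonom u | u. u \<in> words n \<and> length u > j}"

definition completed_ideal :: "nat \<Rightarrow> 'k::field ncpoly \<Rightarrow> 'k ncpoly set" where
  "completed_ideal n F =
    (\<Inter>j. potential_ideal n F <+>\<^bsub>free_algebra n\<^esub> degree_ideal n j)"

definition completed_potential_algebra :: "nat \<Rightarrow> 'k::field ncpoly \<Rightarrow> 'k ncpoly set ring" where
  "completed_potential_algebra n F = free_algebra n Quot completed_ideal n F"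

definition var_class :: "nat \<Rightarrow> 'k::field ncpoly \<Rightarrow> nat \<Rightarrow> 'k ncpoly set" where
  "var_class n F i = completed_ideal n F +>\<^bsub>free_algebra n\<^esub> ncmonom [i]"

text \<open>
  Polynomial functions in the coefficients of \<open>F\<close>. Being functions, they are compared by their
  values: over a finite field a non-zero polynomial can be the zero function.
\<close>

inductive coeff_polynomial_function :: "('k::field ncpoly \<Rightarrow> 'k) \<Rightarrow> bool" where
  coeff: "coeff_polynomial_function (\<lambda>F. Poly_Mapping.lookup F u)"
| const: "coeff_polynomial_function (\<lambda>F. c)"
| add: "coeff_polynomial_function p \<Longrightarrow> coeff_polynomial_function q \<Longrightarrow>
    coeff_polynomial_function (\<lambda>F. p F + q F)"
| mult: "coeff_polynomial_function p \<Longrightarrow> coeff_polynomial_function q \<Longrightarrow>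
    coeff_polynomial_function (\<lambda>F. p F * q F)"

text \<open>
  \<open>P\<close> holds outside a countable union of zero sets in \<open>V\<close> of polynomial functions that do not
  vanish identically on \<open>V\<close>.
\<close>

definition generically :: "'k::field ncpoly set \<Rightarrow> ('k ncpoly \<Rightarrow> bool) \<Rightarrow> bool" where
  "generically V P \<longleftrightarrow>
    (\<exists>\<Phi>. countable \<Phi>
      \<and> (\<forall>p\<in>\<Phi>. coeff_polynomial_function p \<and> (\<exists>F\<in>V. p F \<noteq> 0))
      \<and> (\<forall>F \<in> V - (\<Union>p\<in>\<Phi>. {F\<in>V. p F = 0}). P F))"

lemma cyc_rotate_single [simp]:
  "cyc_rotate (Poly_Mapping.single u c) = Poly_Mapping.single (rotate1 u) c"
  by (cases "c = 0") (simp_all add: cyc_rotate_def)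

lemma nc_deriv_single:
  "nc_deriv j (Poly_Mapping.single u c) =
    (if u \<noteq> [] \<and> hd u = j then Poly_Mapping.single (tl u) c else 0)"
proof (cases "c = 0")
  case False
  then have "{v. v \<in> Poly_Mapping.keys (Poly_Mapping.single u c) \<and> v \<noteq> [] \<and> hd v = j} =
    (if u \<noteq> [] \<and> hd u = j then {u} else {})" by auto
  then show ?thesis by (simp add: nc_deriv_def)
qed (simp add: nc_deriv_def)

lemma ncmonom_mult: "ncmonom u * ncmonom v = ncmonom (u @ v)"
  by (simp add: ncmonom_def mult_single plus_list_def)

lemma words_append: "u \<in> words n \<Longrightarrow> v \<in> words n \<Longrightarrow> u + v \<in> words n"
  by (simp add: words_def plus_list_def)

lemma ring_free_algebra: "ring (free_algebra n :: 'k::field ncpoly ring)"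
proof (rule ringI)
  show "abelian_group (free_algebra n :: 'k ncpoly ring)"
  proof (rule abelian_groupI)
    fix x y :: "'k ncpoly"
    assume "x \<in> carrier (free_algebra n)" "y \<in> carrier (free_algebra n)"
    then show "x \<oplus>\<^bsub>free_algebra n\<^esub> y \<in> carrier (free_algebra n)"
      using Poly_Mapping.keys_add[of x y] by (auto simp: free_algebra_def)
  next
    fix x :: "'k ncpoly"
    assume "x \<in> carrier (free_algebra n)"
    then show "\<exists>y\<in>carrier (free_algebra n). y \<oplus>\<^bsub>free_algebra n\<^esub> x = \<zero>\<^bsub>free_algebra n\<^esub>"
      by (intro bexI[of _ "- x"]) (auto simp: free_algebra_def)
  qed (auto simp: free_algebra_def algebra_simps)
  show "Group.monoid (free_algebra n :: 'k ncpoly ring)"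
  proof (rule monoidI)
    fix x y :: "'k ncpoly"
    assume "x \<in> carrier (free_algebra n)" "y \<in> carrier (free_algebra n)"
    then show "x \<otimes>\<^bsub>free_algebra n\<^esub> y \<in> carrier (free_algebra n)"
      using Poly_Mapping.keys_mult[of x y] words_append
      by (fastforce simp: free_algebra_def)
  qed (auto simp: free_algebra_def algebra_simps words_def zero_list_def)
qed (auto simp: free_algebra_def algebra_simps)

end

theory Submission
  imports Defs "HOL.Vector_Spaces" "HOL-Library.Sublist"
begin

text \<open>
  Write \<open>r\<^sub>i\<close> for the derivative of \<open>F\<close> with respect to \<open>x\<^sub>i\<close>. For one special homogeneous
  potential the \<open>r\<^sub>i\<close> have leading words with a single overlap and none of them starts with
  \<open>x\<^sub>1\<close>, so the normal words (those avoiding the leading words) span the algebra and are closed under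
  prepending \<open>x\<^sub>1\<close>. Up to any given degree, spanning by normal words is an open condition, hence it
  holds for generic \<open>F\<close>. On the other hand, cyclic invariance gives the syzygy
  \<open>\<Sum>x\<^sub>i r\<^sub>i = \<Sum>r\<^sub>i x\<^sub>i\<close>, so that \<open>I = \<Sum>x\<^sub>i I + \<Sum>r\<^sub>i W\<close>, where \<open>W\<close> consists of the normal words
  and the products \<open>r\<^sub>1 x\<^sub>1 w\<close> may be omitted. Counting generators in truncated degree then shows that
  the normal words and a spanning set of \<open>I\<close> are together at most as many as all words; hence the
  normal words are linearly independent modulo \<open>I\<close>. Since left multiplication by \<open>x\<^sub>1\<close> maps this
  basis injectively into the next one, it is injective.
\<close>

subsection \<open>Linear algebra in the free algebra\<close>

text \<open>Scalars act as the constants \<open>single [] c\<close>. Being a product, scaling stays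
  inside every ideal, and the interpretation below makes spans and independence available.\<close>

definition nc_scale :: "'k::field \<Rightarrow> 'k ncpoly \<Rightarrow> 'k ncpoly" where
  "nc_scale c f = Poly_Mapping.single [] c * f"

lemma lookup_nc_scale [simp]: "Poly_Mapping.lookup (nc_scale c f) u = c * Poly_Mapping.lookup f u"
  unfolding nc_scale_def zero_list_def[symmetric] mult_map_scale_conv_mult[symmetric]
  by (simp add: Poly_Mapping.map.rep_eq when_def)

interpretation ncp: vector_space "nc_scale :: 'k::field \<Rightarrow> 'k ncpoly \<Rightarrow> 'k ncpoly"
  by unfold_locales (simp_all add: poly_mapping_eq_iff fun_eq_iff lookup_add algebra_simps)

interpretation ncpp: vector_space_pair "nc_scale :: 'k::field \<Rightarrow> 'k ncpoly \<Rightarrow> 'k ncpoly" nc_scale ..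

lemma nc_scale_mult_left: "nc_scale c f * g = nc_scale c (f * g)"
  by (simp add: nc_scale_def mult.assoc)

lemma ncmonom_Nil: "ncmonom [] = 1"
  unfolding ncmonom_def zero_list_def[symmetric] by simp

lemma lookup_ncmonom: "Poly_Mapping.lookup (ncmonom u) w = (if u = w then 1 else 0)"
  by (simp add: ncmonom_def lookup_single when_def)

lemma keys_ncmonom: "Poly_Mapping.keys (ncmonom u :: 'k::field ncpoly) = {u}"
  by (simp add: ncmonom_def)

lemma inj_ncmonom: "inj (ncmonom :: nat list \<Rightarrow> 'k::field ncpoly)"
  by (rule injI) (metis keys_ncmonom singleton_inject)

lemma keys_subset_imp_span:
  assumes "Poly_Mapping.keys (f :: 'k::field ncpoly) \<subseteq> A"
  shows "f \<in> ncp.span (ncmonom ` A)"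
proof -
  have "f = (\<Sum>u\<in>Poly_Mapping.keys f. nc_scale (Poly_Mapping.lookup f u) (ncmonom u))"
    by (rule poly_mapping_eqI)
      (auto simp: lookup_sum lookup_ncmonom if_distrib sum.If_cases in_keys_iff cong: if_cong)
  moreover have "\<dots> \<in> ncp.span (ncmonom ` A)"
    using assms by (intro ncp.span_sum ncp.span_scale ncp.span_base) auto
  ultimately show ?thesis by simp
qed

lemma span_ncmonom: "ncp.span (ncmonom ` A) = {f :: 'k::field ncpoly. Poly_Mapping.keys f \<subseteq> A}"
proof (intro equalityI subsetI)
  fix f :: "'k ncpoly" assume "f \<in> ncp.span (ncmonom ` A)"
  then have "\<forall>u. u \<notin> A \<longrightarrow> Poly_Mapping.lookup f u = 0"
    by (induction rule: ncp.span_induct_alt) (auto simp: lookup_add lookup_ncmonom split: if_splits)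
  then show "f \<in> {f. Poly_Mapping.keys f \<subseteq> A}" by (auto simp: in_keys_iff)
qed (use keys_subset_imp_span in auto)

lemma nc_induct [case_names zero add]:
  assumes "P 0" and "\<And>c u f. P f \<Longrightarrow> P (nc_scale c (ncmonom u) + f)"
  shows "P (f :: 'k::field ncpoly)"
proof -
  have "f \<in> ncp.span (range ncmonom)" using keys_subset_imp_span[of f UNIV] by simp
  then show ?thesis
    by (induction rule: ncp.span_induct_alt) (use assms in auto)
qed

lemma independent_ncmonom: "ncp.independent (ncmonom ` A :: 'k::field ncpoly set)"
proof
  assume "ncp.dependent (ncmonom ` A :: 'k ncpoly set)"
  then obtain u where "u \<in> A"
    and u: "ncmonom u \<in> ncp.span (ncmonom ` A - {ncmonom u :: 'k ncpoly})"
    by (auto simp: ncp.dependent_def)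
  have "ncmonom ` A - {ncmonom u :: 'k ncpoly} = ncmonom ` (A - {u})"
    using inj_ncmonom[where 'k='k] by (auto simp: inj_def)
  with u show False by (auto simp: span_ncmonom keys_ncmonom)
qed

lemma nc_scale_mult_right: "f * nc_scale c g = nc_scale c (f * g)"
proof (induction f rule: nc_induct)
  case (add d u f)
  have "ncmonom u * nc_scale c g = nc_scale c (ncmonom u * g)"
    unfolding nc_scale_def ncmonom_def mult.assoc[symmetric] by (simp add: mult_single plus_list_def)
  then have "nc_scale d (ncmonom u) * nc_scale c g = nc_scale c (nc_scale d (ncmonom u) * g)"
    unfolding nc_scale_mult_left by (metis ncp.scale_left_commute)
  then show ?case
    using add by (simp add: distrib_right ncp.scale_right_distrib)
qed simp

lemma linear_mult_left: "Vector_Spaces.linear nc_scale nc_scale ((*) (f :: 'k::field ncpoly))"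
  by (auto simp: linear_iff algebra_simps nc_scale_mult_right ncp.vector_space_axioms)

lemma linear_mult_right: "Vector_Spaces.linear nc_scale nc_scale (\<lambda>g. g * (f :: 'k::field ncpoly))"
  by (auto simp: linear_iff algebra_simps nc_scale_mult_left ncp.vector_space_axioms)

lemma linear_in_span:
  assumes "Vector_Spaces.linear nc_scale nc_scale (h :: 'k::field ncpoly \<Rightarrow> 'k ncpoly)"
    and "x \<in> ncp.span A" and "\<And>a. a \<in> A \<Longrightarrow> h a \<in> ncp.span B"
  shows "h x \<in> ncp.span B"
proof -
  have "h ` A \<subseteq> ncp.span B" using assms(3) by blast
  then have "ncp.span (h ` A) \<subseteq> ncp.span B" by (metis ncp.span_mono ncp.span_span)
  then show ?thesis using ncpp.linear_span_image[OF assms(1), of A] assms(2) by blast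
qed

section \<open>Products with a monomial and truncation to a set of words\<close>

lemma lookup_ncmonom_mult:
  "Poly_Mapping.lookup (ncmonom u * f) w =
    (if prefix u w then Poly_Mapping.lookup f (drop (length u) w) else 0)"
proof (induction f rule: nc_induct)
  case (add c v f)
  then show ?case
    by (cases "prefix u w")
      (auto simp: distrib_left lookup_add nc_scale_mult_right ncmonom_mult lookup_ncmonom prefix_def)
qed simp

lemma lookup_mult_ncmonom:
  "Poly_Mapping.lookup (f * ncmonom u) w =
    (if suffix u w then Poly_Mapping.lookup f (take (length w - length u) w) else 0)"
proof (induction f rule: nc_induct)
  case (add c v f)
  then show ?case
    by (cases "suffix u w")
      (auto simp: distrib_right lookup_add nc_scale_mult_left ncmonom_mult lookup_ncmonom suffix_def)
qed simp

text \<open>The coordinate projection onto the words in \<open>A\<close>. For the words of length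
  below \<open>N\<close> it replaces computation modulo high degree by honest elements of a finite
  dimensional space.\<close>

lift_definition restrict_words :: "nat list set \<Rightarrow> 'k::field ncpoly \<Rightarrow> 'k ncpoly" is
  "\<lambda>A f u. if u \<in> A then f u else 0"
  by (erule rev_finite_subset) auto

lemma lookup_restrict_words [simp]:
  "Poly_Mapping.lookup (restrict_words A f) u = (if u \<in> A then Poly_Mapping.lookup f u else 0)"
  by transfer simp

lemma linear_restrict_words:
  "Vector_Spaces.linear nc_scale nc_scale (restrict_words A :: 'k::field ncpoly \<Rightarrow> _)"
  by (auto simp: linear_iff poly_mapping_eq_iff fun_eq_iff lookup_add ncp.vector_space_axioms)

lemma restrict_words_ncmonom:
  "restrict_words A (ncmonom u) = (if u \<in> A then ncmonom u else 0)"
  by (auto simp: poly_mapping_eq_iff fun_eq_iff lookup_ncmonom)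

lemma restrict_words_eq_0_iff:
  "restrict_words A f = 0 \<longleftrightarrow> Poly_Mapping.keys f \<inter> A = {}"
  by (auto simp: poly_mapping_eq_iff fun_eq_iff in_keys_iff)

section \<open>Coefficients of derivatives and the two Euler identities\<close>

lemma lookup_nc_deriv: "Poly_Mapping.lookup (nc_deriv j f) w = Poly_Mapping.lookup f (j # w)"
proof -
  have "Poly_Mapping.lookup (nc_deriv j f) w =
    (\<Sum>u | u \<in> Poly_Mapping.keys f \<and> u \<noteq> [] \<and> hd u = j.
       if u = j # w then Poly_Mapping.lookup f u else 0)"
    unfolding nc_deriv_def lookup_sum
    by (rule sum.cong) (auto simp: lookup_single when_def neq_Nil_conv)
  also have "\<dots> = Poly_Mapping.lookup f (j # w)"
    by (auto simp: sum.If_cases in_keys_iff)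
  finally show ?thesis .
qed

lemma lookup_hom_component:
  "Poly_Mapping.lookup (hom_component j f) u = (if length u = j then Poly_Mapping.lookup f u else 0)"
proof -
  have "Poly_Mapping.lookup (hom_component j f) u =
    (\<Sum>v | v \<in> Poly_Mapping.keys f \<and> length v = j. if v = u then Poly_Mapping.lookup f u else 0)"
    unfolding hom_component_def lookup_sum
    by (rule sum.cong) (auto simp: lookup_single when_def)
  also have "\<dots> = (if length u = j then Poly_Mapping.lookup f u else 0)"
    by (auto simp: sum.If_cases in_keys_iff)
  finally show ?thesis .
qed

text \<open>Every nonempty word has exactly one first letter, which the derivative strips and the
  product restores; a constant term would be lost.\<close>

lemma euler_left:
  assumes "Poly_Mapping.keys f \<subseteq> words n" and "[] \<notin> Poly_Mapping.keys f"
  shows "(\<Sum>j\<in>{1..n}. ncmonom [j] * nc_deriv j f) = f"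
proof (rule poly_mapping_eqI)
  fix w
  show "Poly_Mapping.lookup (\<Sum>j\<in>{1..n}. ncmonom [j] * nc_deriv j f) w = Poly_Mapping.lookup f w"
    using assms
    by (cases w) (auto simp: lookup_sum lookup_ncmonom_mult lookup_nc_deriv in_keys_iff words_def
        sum.If_cases subset_iff split: if_splits)
qed

text \<open>Restoring the stripped letter at the other end is one rotation. For a cyclically
  invariant \<open>f\<close> both Euler sums are therefore \<open>f\<close>, and equating them gives
  the syzygy.\<close>

lemma euler_right:
  assumes "Poly_Mapping.keys f \<subseteq> words n" and "[] \<notin> Poly_Mapping.keys f"
  shows "(\<Sum>j\<in>{1..n}. nc_deriv j f * ncmonom [j]) = cyc_rotate f"
proof -
  let ?K = "Poly_Mapping.keys f"
  have hd: "hd u \<in> {1..n}" if "u \<in> ?K" for u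
    using assms that by (cases u) (auto simp: words_def subset_iff)
  have rot: "rotate1 u = tl u @ [hd u]" if "u \<in> ?K" for u
    using assms(2) that by (cases u) auto
  have eq: "{u \<in> ?K. u \<noteq> [] \<and> hd u = j} = {u \<in> ?K. hd u = j}" for j
    using assms(2) by auto
  have "(\<Sum>j\<in>{1..n}. nc_deriv j f * ncmonom [j]) =
    (\<Sum>j\<in>{1..n}. \<Sum>u | u \<in> ?K \<and> hd u = j.
      Poly_Mapping.single (rotate1 u) (Poly_Mapping.lookup f u))"
    unfolding nc_deriv_def sum_distrib_right eq
    by (intro sum.cong refl) (simp add: ncmonom_def mult_single plus_list_def rot)
  also have "\<dots> = cyc_rotate f"
    unfolding cyc_rotate_def by (rule sum.group) (use hd in auto)
  finally show ?thesis .
qed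

subsection \<open>Ideals as spans\<close>

text \<open>Words span the algebra and multiplication is linear in each factor, so stability under
  arbitrary factors reduces to words acting on generators.\<close>

lemma span_is_ideal:
  fixes G :: "'k::field ncpoly set"
  assumes carr: "G \<subseteq> carrier (free_algebra n)"
    and l: "\<And>u g. u \<in> words n \<Longrightarrow> g \<in> G \<Longrightarrow> ncmonom u * g \<in> ncp.span G"
    and r: "\<And>u g. u \<in> words n \<Longrightarrow> g \<in> G \<Longrightarrow> g * ncmonom u \<in> ncp.span G"
  shows "ideal (ncp.span G) (free_algebra n)"
proof (rule idealI[OF ring_free_algebra])
  interpret R: ring "free_algebra n :: 'k ncpoly ring" by (rule ring_free_algebra)
  have carrier: "carrier (free_algebra n) = ncp.span (ncmonom ` words n :: 'k ncpoly set)"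
    by (simp add: free_algebra_def span_ncmonom)
  have sub: "ncp.span G \<subseteq> carrier (free_algebra n)"
    using carr unfolding carrier by (metis ncp.span_mono ncp.span_span)
  show "subgroup (ncp.span G) (add_monoid (free_algebra n))"
  proof (rule group.subgroupI)
    show "Group.group (add_monoid (free_algebra n :: 'k ncpoly ring))" by (rule R.a_group)
    show "ncp.span G \<subseteq> carrier (add_monoid (free_algebra n))" using sub by simp
    show "ncp.span G \<noteq> {}" using ncp.span_zero by blast
  next
    fix a assume a: "a \<in> ncp.span G"
    have "\<ominus>\<^bsub>free_algebra n\<^esub> a = - a"
      using a sub
      by (intro R.minus_equality) (auto simp: free_algebra_def)
    then show "inv\<^bsub>add_monoid (free_algebra n)\<^esub> a \<in> ncp.span G"
      using a by (simp add: a_inv_def ncp.span_neg)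
  next
    fix a b assume "a \<in> ncp.span G" "b \<in> ncp.span G"
    then show "a \<otimes>\<^bsub>add_monoid (free_algebra n)\<^esub> b \<in> ncp.span G"
      by (simp add: free_algebra_def ncp.span_add)
  qed
next
  fix a x :: "'k ncpoly" assume a: "a \<in> ncp.span G" and x: "x \<in> carrier (free_algebra n)"
  have x: "x \<in> ncp.span (ncmonom ` words n)"
    using x by (simp add: free_algebra_def span_ncmonom)
  have "ncmonom u * a \<in> ncp.span G" if "u \<in> words n" for u
    using l that by (intro linear_in_span[OF linear_mult_left a]) auto
  then have "x * a \<in> ncp.span G"
    by (intro linear_in_span[OF linear_mult_right x]) auto
  then show "x \<otimes>\<^bsub>free_algebra n\<^esub> a \<in> ncp.span G" by (simp add: free_algebra_def)
  have "a * ncmonom u \<in> ncp.span G" if "u \<in> words n" for u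
    using r that by (intro linear_in_span[OF linear_mult_right a]) auto
  then have "a * x \<in> ncp.span G"
    by (intro linear_in_span[OF linear_mult_left x]) auto
  then show "a \<otimes>\<^bsub>free_algebra n\<^esub> x \<in> ncp.span G" by (simp add: free_algebra_def)
qed

text \<open>A ring ideal is only assumed closed under addition and ring multiplication; it is a
  subspace because scaling multiplies by a constant of the algebra.\<close>

lemma ideal_span_subset:
  fixes G :: "'k::field ncpoly set"
  assumes "ideal J (free_algebra n)" and "G \<subseteq> J"
  shows "ncp.span G \<subseteq> J"
proof
  interpret ideal J "free_algebra n :: 'k ncpoly ring" by (rule assms)
  fix x assume "x \<in> ncp.span G"
  then show "x \<in> J"
  proof (induction rule: ncp.span_induct_alt)
    case base
    show ?case using additive_subgroup.zero_closed[OF is_additive_subgroup] by (simp add: free_algebra_def)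
  next
    case (step c x y)
    have "Poly_Mapping.single [] c \<in> carrier (free_algebra n)"
      by (auto simp: free_algebra_def words_def)
    then have "nc_scale c x \<in> J"
      using I_l_closed[of x "Poly_Mapping.single [] c"] subsetD[OF assms(2) step(1)]
      by (simp add: free_algebra_def nc_scale_def)
    then show ?case
      using additive_subgroup.a_closed[OF is_additive_subgroup _ step(2), of "nc_scale c x"]
      by (simp add: free_algebra_def)
  qed
qed

text \<open>Passes from generated ideals to linear spans. One inclusion is minimality of the
  generated ideal; the other applies \<open>XG\<close> to the generated ideal itself.\<close>

lemma genideal_eq_span:
  fixes G X :: "'k::field ncpoly set"
  assumes G: "ideal (ncp.span G) (free_algebra n)"
    and X: "X \<subseteq> ncp.span G" and XG: "\<And>J. ideal J (free_algebra n) \<Longrightarrow> X \<subseteq> J \<Longrightarrow> G \<subseteq> J"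
  shows "Idl\<^bsub>free_algebra n\<^esub> X = ncp.span G"
proof
  interpret R: ring "free_algebra n :: 'k ncpoly ring" by (rule ring_free_algebra)
  show "Idl\<^bsub>free_algebra n\<^esub> X \<subseteq> ncp.span G"
    using R.genideal_minimal[OF G X] .
  have "X \<subseteq> carrier (free_algebra n)"
    using X additive_subgroup.a_subset[OF ideal.axioms(1)[OF G]] by (rule subset_trans)
  then have "ideal (Idl\<^bsub>free_algebra n\<^esub> X) (free_algebra n)" "X \<subseteq> Idl\<^bsub>free_algebra n\<^esub> X"
    by (rule R.genideal_ideal, rule R.genideal_self)
  then show "ncp.span G \<subseteq> Idl\<^bsub>free_algebra n\<^esub> X"
    by (intro ideal_span_subset XG)
qed

section \<open>The degree ideals and the ideal of relations as linear spans\<close>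

lemma degree_ideal_eq:
  "degree_ideal n j = {f :: 'k::field ncpoly. Poly_Mapping.keys f \<subseteq> {u \<in> words n. length u > j}}"
proof -
  let ?G = "ncmonom ` {u \<in> words n. length u > j} :: 'k ncpoly set"
  have "degree_ideal n j = ncp.span ?G"
    unfolding degree_ideal_def
  proof (rule genideal_eq_span)
    show "ideal (ncp.span ?G) (free_algebra n)"
      by (rule span_is_ideal)
        (auto simp: free_algebra_def keys_ncmonom ncmonom_mult words_def intro!: ncp.span_base imageI)
    show "{ncmonom u |u. u \<in> words n \<and> j < length u} \<subseteq> ncp.span ?G"
      by (auto intro!: ncp.span_base imageI)
  qed auto
  then show ?thesis by (simp add: span_ncmonom)
qed

text \<open>Linear generators of the two-sided ideal, so that membership in it becomes a question
  about spans.\<close>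

definition relation_words :: "nat \<Rightarrow> 'k::field ncpoly \<Rightarrow> 'k ncpoly set" where
  "relation_words n F =
    (\<lambda>(u, i, v). ncmonom u * nc_deriv i F * ncmonom v) ` (words n \<times> {1..n} \<times> words n)"

lemma relation_wordsI:
  "u \<in> words n \<Longrightarrow> i \<in> {1..n} \<Longrightarrow> v \<in> words n \<Longrightarrow>
    ncmonom u * nc_deriv i F * ncmonom v \<in> relation_words n F"
  unfolding relation_words_def by (rule image_eqI[of _ _ "(u, i, v)"]) auto

lemma keys_nc_deriv:
  "Poly_Mapping.keys F \<subseteq> words n \<Longrightarrow> Poly_Mapping.keys (nc_deriv i F) \<subseteq> words n"
proof
  fix w assume F: "Poly_Mapping.keys F \<subseteq> words n" and "w \<in> Poly_Mapping.keys (nc_deriv i F)"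
  then have "i # w \<in> words n" by (auto simp: in_keys_iff lookup_nc_deriv)
  then show "w \<in> words n" by (simp add: words_def)
qed

lemma potential_ideal_eq_span:
  fixes F :: "'k::field ncpoly"
  assumes F: "Poly_Mapping.keys F \<subseteq> words n"
  shows "ideal (ncp.span (relation_words n F)) (free_algebra n)"
    and "potential_ideal n F = ncp.span (relation_words n F)"
proof -
  have monom: "ncmonom u \<in> carrier (free_algebra n :: 'k ncpoly ring)" if "u \<in> words n" for u
    using that by (simp add: free_algebra_def keys_ncmonom)
  interpret R: ring "free_algebra n :: 'k ncpoly ring" by (rule ring_free_algebra)
  have mult: "x * y \<in> carrier (free_algebra n)"
    if "x \<in> carrier (free_algebra n)" "y \<in> carrier (free_algebra n)" for x y :: "'k ncpoly"
    using R.m_closed[OF that] by (simp add: free_algebra_def)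
  have Nil: "[] \<in> words n" by (simp add: words_def)
  show id: "ideal (ncp.span (relation_words n F)) (free_algebra n)"
  proof (rule span_is_ideal)
    show "relation_words n F \<subseteq> carrier (free_algebra n)"
    proof
      fix g assume "g \<in> relation_words n F"
      then obtain u i v where g: "g = ncmonom u * nc_deriv i F * ncmonom v"
        and uv: "u \<in> words n" "v \<in> words n"
        by (auto simp: relation_words_def)
      have "nc_deriv i F \<in> carrier (free_algebra n)"
        using keys_nc_deriv[OF F, of i] by (simp add: free_algebra_def)
      then show "g \<in> carrier (free_algebra n)"
        unfolding g using uv by (intro mult monom)
    qed
  next
    fix w g assume w: "w \<in> words n" and "g \<in> relation_words n F"
    then obtain u i v where g: "g = ncmonom u * nc_deriv i F * ncmonom v"
      and uv: "u \<in> words n" "i \<in> {1..n}" "v \<in> words n"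
      by (auto simp: relation_words_def)
    have "ncmonom w * g = ncmonom (w @ u) * nc_deriv i F * ncmonom v"
      unfolding g ncmonom_mult[symmetric] by (simp only: mult.assoc)
    moreover have "g * ncmonom w = ncmonom u * nc_deriv i F * ncmonom (v @ w)"
      unfolding g ncmonom_mult[symmetric] by (simp only: mult.assoc)
    moreover have "w @ u \<in> words n" "v @ w \<in> words n"
      using w uv by (auto simp: words_def)
    ultimately show "ncmonom w * g \<in> ncp.span (relation_words n F)"
      "g * ncmonom w \<in> ncp.span (relation_words n F)"
      using uv by (auto intro!: ncp.span_base relation_wordsI)
  qed
  show "potential_ideal n F = ncp.span (relation_words n F)"
    unfolding potential_ideal_def
  proof (rule genideal_eq_span[OF id])
    have "nc_deriv j F \<in> relation_words n F" if "j \<in> {1..n}" for j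
      using relation_wordsI[OF Nil that Nil] by (simp add: ncmonom_Nil)
    then show "{nc_deriv j F |j. j \<in> {1..n}} \<subseteq> ncp.span (relation_words n F)"
      by (auto intro: ncp.span_base)
  next
    fix J assume "ideal J (free_algebra n)" and X: "{nc_deriv j F |j. j \<in> {1..n}} \<subseteq> J"
    then interpret J: ideal J "free_algebra n :: 'k ncpoly ring" by simp
    show "relation_words n F \<subseteq> J"
    proof
      fix g assume "g \<in> relation_words n F"
      then obtain u i v where g: "g = ncmonom u * nc_deriv i F * ncmonom v"
        and uv: "u \<in> words n" "i \<in> {1..n}" "v \<in> words n"
        by (auto simp: relation_words_def)
      have "nc_deriv i F \<in> J" using X uv by blast
      then have "ncmonom u * nc_deriv i F \<in> J"
        using J.I_l_closed[of "nc_deriv i F" "ncmonom u"] monom[OF uv(1)]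
        by (simp add: free_algebra_def)
      then show "g \<in> J"
        using J.I_r_closed[of "ncmonom u * nc_deriv i F" "ncmonom v"] monom[OF uv(3)]
        by (simp add: free_algebra_def g)
    qed
  qed
qed

subsection \<open>Generic spanning\<close>

lemma coeff_polynomial_function_diff:
  assumes "coeff_polynomial_function p" and "coeff_polynomial_function q"
  shows "coeff_polynomial_function (\<lambda>F. p F - q F)"
  using coeff_polynomial_function.add[OF assms(1)
      coeff_polynomial_function.mult[OF coeff_polynomial_function.const[of "-1"] assms(2)]]
  by simp

text \<open>
  Fraction-free Gaussian elimination: the polynomial is the product of the pivots met at \<open>F\<^sub>0\<close>.
\<close>

lemma spanning_generic:
  fixes H :: "('k::field ncpoly \<Rightarrow> 'k ncpoly) set"
  assumes "finite S"
    and "\<And>h s. h \<in> H \<Longrightarrow> coeff_polynomial_function (\<lambda>F. Poly_Mapping.lookup (h F) s)"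
    and "\<And>h F. h \<in> H \<Longrightarrow> Poly_Mapping.keys (h F) \<subseteq> S"
    and "\<And>s. s \<in> S \<Longrightarrow> ncmonom s \<in> ncp.span ((\<lambda>h. h F\<^sub>0) ` H)"
  shows "\<exists>p. coeff_polynomial_function p \<and> p F\<^sub>0 \<noteq> 0 \<and>
    (\<forall>F. p F \<noteq> 0 \<longrightarrow> (\<forall>s\<in>S. ncmonom s \<in> ncp.span ((\<lambda>h. h F) ` H)))"
  using assms
proof (induction S arbitrary: H rule: finite_induct)
  case empty
  show ?case by (intro exI[of _ "\<lambda>_. 1"]) (auto intro: coeff_polynomial_function.const)
next
  case (insert s S)
  note poly = insert.prems(1) and keys = insert.prems(2) and sp = insert.prems(3)
  let ?c = "\<lambda>h F. Poly_Mapping.lookup (h F) s"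
  \<comment> \<open>A pivot exists: otherwise the coefficient of \<open>s\<close> would vanish on
    the whole span at \<open>F\<^sub>0\<close>, which contains \<open>ncmonom s\<close>.\<close>
  have "\<exists>h\<in>H. ?c h F\<^sub>0 \<noteq> 0"
  proof (rule ccontr)
    assume *: "\<not> ?thesis"
    have "Poly_Mapping.lookup x s = 0" if "x \<in> ncp.span ((\<lambda>h. h F\<^sub>0) ` H)" for x
      using that by (induction rule: ncp.span_induct_alt) (use * in \<open>auto simp: lookup_add\<close>)
    from this[OF sp[of s]] show False by (simp add: lookup_ncmonom)
  qed
  then obtain h\<^sub>0 where h\<^sub>0: "h\<^sub>0 \<in> H" "?c h\<^sub>0 F\<^sub>0 \<noteq> 0" by blast
  \<comment> \<open>Cross-multiplication kills the coefficient of \<open>s\<close> for every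
    \<open>F\<close> without dividing, so all coefficients stay polynomial in
    \<open>F\<close>.\<close>
  define elim where "elim h F = nc_scale (?c h\<^sub>0 F) (h F) - nc_scale (?c h F) (h\<^sub>0 F)" for h F
  have lookup_elim: "Poly_Mapping.lookup (elim h F) t =
      ?c h\<^sub>0 F * Poly_Mapping.lookup (h F) t - ?c h F * Poly_Mapping.lookup (h\<^sub>0 F) t" for h F t
    by (simp add: elim_def lookup_minus)
  have "\<exists>p. coeff_polynomial_function p \<and> p F\<^sub>0 \<noteq> 0 \<and>
    (\<forall>F. p F \<noteq> 0 \<longrightarrow> (\<forall>s\<in>S. ncmonom s \<in> ncp.span ((\<lambda>h. h F) ` elim ` H)))"
  proof (rule insert.IH)
    fix h t assume "h \<in> elim ` H"
    then obtain h' where h': "h = elim h'" "h' \<in> H" by blast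
    show "coeff_polynomial_function (\<lambda>F. Poly_Mapping.lookup (h F) t)"
      unfolding h'(1) lookup_elim
      by (rule coeff_polynomial_function_diff; rule coeff_polynomial_function.mult; rule poly)
        (use h' h\<^sub>0 in auto)
  next
    fix h F assume "h \<in> elim ` H"
    then obtain h' where h': "h = elim h'" "h' \<in> H" by blast
    show "Poly_Mapping.keys (h F) \<subseteq> S"
    proof
      fix t assume t: "t \<in> Poly_Mapping.keys (h F)"
      then have "t \<noteq> s" by (auto simp: h' in_keys_iff lookup_elim mult.commute)
      moreover have "t \<in> Poly_Mapping.keys (h' F) \<union> Poly_Mapping.keys (h\<^sub>0 F)"
        using t by (auto simp: h' in_keys_iff lookup_elim)
      ultimately show "t \<in> S" using keys h' h\<^sub>0 by blast
    qed
  next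
    fix t assume t: "t \<in> S"
    \<comment> \<open>At \<open>F\<^sub>0\<close>, elimination is one linear map applied to each
      \<open>h F\<^sub>0\<close>. It multiplies the monomial of any word \<open>t\<close> other than
      \<open>s\<close> by the pivot, so spanning survives elimination.\<close>
    let ?P = "\<lambda>f. nc_scale (?c h\<^sub>0 F\<^sub>0) f - nc_scale (Poly_Mapping.lookup f s) (h\<^sub>0 F\<^sub>0)"
    have lin: "Vector_Spaces.linear nc_scale nc_scale ?P"
      by (auto simp: linear_iff poly_mapping_eq_iff fun_eq_iff lookup_add lookup_minus algebra_simps
          ncp.vector_space_axioms)
    have "?P (h F\<^sub>0) \<in> ncp.span ((\<lambda>h. h F\<^sub>0) ` elim ` H)" if "h \<in> H" for h
      unfolding elim_def[of h F\<^sub>0, symmetric] using that by (intro ncp.span_base imageI)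
    then have "?P (ncmonom t) \<in> ncp.span ((\<lambda>h. h F\<^sub>0) ` elim ` H)"
      by (intro linear_in_span[OF lin sp]) (use t in auto)
    moreover have "?P (ncmonom t) = nc_scale (?c h\<^sub>0 F\<^sub>0) (ncmonom t)"
      using t insert.hyps by (auto simp: lookup_ncmonom)
    ultimately have "nc_scale (inverse (?c h\<^sub>0 F\<^sub>0)) (nc_scale (?c h\<^sub>0 F\<^sub>0) (ncmonom t))
        \<in> ncp.span ((\<lambda>h. h F\<^sub>0) ` elim ` H)"
      by (simp add: ncp.span_scale del: ncp.scale_scale)
    then show "ncmonom t \<in> ncp.span ((\<lambda>h. h F\<^sub>0) ` elim ` H)"
      using h\<^sub>0(2) by simp
  qed
  then obtain p where p: "coeff_polynomial_function p" "p F\<^sub>0 \<noteq> 0"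
    and psp: "\<And>F t. p F \<noteq> 0 \<Longrightarrow> t \<in> S \<Longrightarrow> ncmonom t \<in> ncp.span ((\<lambda>h. h F) ` elim ` H)"
    by blast
  show ?case
  proof (intro exI[of _ "\<lambda>F. ?c h\<^sub>0 F * p F"] conjI allI impI ballI)
    show "coeff_polynomial_function (\<lambda>F. ?c h\<^sub>0 F * p F)"
      using poly[OF h\<^sub>0(1)] p(1) by (rule coeff_polynomial_function.mult)
    show "?c h\<^sub>0 F\<^sub>0 * p F\<^sub>0 \<noteq> 0" using h\<^sub>0 p by simp
  next
    fix F t assume F: "?c h\<^sub>0 F * p F \<noteq> 0" and t: "t \<in> insert s S"
    let ?V = "ncp.span ((\<lambda>h. h F) ` H)"
    have base: "h F \<in> ?V" if "h \<in> H" for h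
      using that by (intro ncp.span_base imageI)
    have "elim h F \<in> ?V" if "h \<in> H" for h
      unfolding elim_def by (intro ncp.span_diff ncp.span_scale base that h\<^sub>0)
    then have "(\<lambda>h. h F) ` elim ` H \<subseteq> ?V"
      unfolding image_image by (rule image_subsetI)
    then have "ncp.span ((\<lambda>h. h F) ` elim ` H) \<subseteq> ?V"
      by (intro ncp.span_minimal ncp.subspace_span)
    then have S: "ncmonom t \<in> ?V" if "t \<in> S" for t using psp[of F t] F that by auto
    show "ncmonom t \<in> ?V"
    proof (cases "t = s")
      case True
      \<comment> \<open>Back substitution: the part of \<open>h\<^sub>0 F\<close> away from
        \<open>s\<close> lies in the span of the words already obtained, and the pivot is nonzero at
        \<open>F\<close>.\<close>
      let ?f = "h\<^sub>0 F - nc_scale (?c h\<^sub>0 F) (ncmonom s)"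
      have "Poly_Mapping.keys ?f \<subseteq> S"
      proof
        fix w assume w: "w \<in> Poly_Mapping.keys ?f"
        then have "w \<noteq> s" by (auto simp: in_keys_iff lookup_minus lookup_ncmonom)
        moreover from this w have "w \<in> Poly_Mapping.keys (h\<^sub>0 F)"
          by (simp add: in_keys_iff lookup_minus lookup_ncmonom)
        ultimately show "w \<in> S" using keys[OF h\<^sub>0(1), of F] by blast
      qed
      then have "?f \<in> ncp.span (ncmonom ` S)" by (rule keys_subset_imp_span)
      moreover have "ncp.span (ncmonom ` S) \<subseteq> ?V"
        by (intro ncp.span_minimal ncp.subspace_span image_subsetI S)
      ultimately have "h\<^sub>0 F - ?f \<in> ?V"
        using ncp.span_diff[OF base[OF h\<^sub>0(1)]] by blast
      then have "nc_scale (inverse (?c h\<^sub>0 F)) (nc_scale (?c h\<^sub>0 F) (ncmonom s)) \<in> ?V"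
        by (simp add: ncp.span_scale del: ncp.scale_scale)
      then show ?thesis using F True by simp
    qed (use t S in auto)
  qed
qed

text \<open>Such a coefficient is either a single coefficient of \<open>F\<close> or constantly
  zero, according to whether \<open>t\<close> has the form \<open>u @ w @ v\<close>.\<close>

lemma coeff_polynomial_function_relation_word:
  "coeff_polynomial_function
    (\<lambda>F :: 'k::field ncpoly. Poly_Mapping.lookup (ncmonom u * nc_deriv i F * ncmonom v) t)"
  by (cases "suffix v t"; cases "prefix u (take (length t - length v) t)")
    (simp_all add: lookup_mult_ncmonom lookup_ncmonom_mult lookup_nc_deriv
      coeff_polynomial_function.coeff coeff_polynomial_function.const)

text \<open>Spanning at one potential spreads to generic ones. The normal words enter as constant
  functions of \<open>F\<close>, the relations as truncated ones, so that all supports lie in the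
  finite set \<open>S\<close>.\<close>

lemma spanning_modulo_relations_generic:
  fixes F\<^sub>0 :: "'k::field ncpoly"
  assumes S: "finite S" and W: "W \<subseteq> S"
    and sp: "\<And>s. s \<in> S \<Longrightarrow> ncmonom s \<in> ncp.span (ncmonom ` W \<union> relation_words n F\<^sub>0)"
  shows "\<exists>p. coeff_polynomial_function p \<and> p F\<^sub>0 \<noteq> 0 \<and>
    (\<forall>F. p F \<noteq> 0 \<longrightarrow> (\<forall>s\<in>S. \<exists>h\<in>ncp.span (ncmonom ` W). \<exists>g\<in>ncp.span (relation_words n F).
       restrict_words S (ncmonom s - h - g) = 0))"
proof -
  note lin = linear_restrict_words[of S, where 'k='k]
  define H\<^sub>1 :: "('k ncpoly \<Rightarrow> 'k ncpoly) set" where "H\<^sub>1 = (\<lambda>w _. ncmonom w) ` W"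
  define H\<^sub>2 :: "('k ncpoly \<Rightarrow> 'k ncpoly) set" where
    "H\<^sub>2 = (\<lambda>(u, i, v) F. restrict_words S (ncmonom u * nc_deriv i F * ncmonom v)) `
      (words n \<times> {1..n} \<times> words n)"
  have img: "(\<lambda>h. h F) ` (H\<^sub>1 \<union> H\<^sub>2) = ncmonom ` W \<union> restrict_words S ` relation_words n F" for F
    unfolding relation_words_def H\<^sub>1_def H\<^sub>2_def image_Un image_image
    by (simp add: case_prod_beta)
  have img_span: "ncp.span (restrict_words S ` relation_words n F) =
      restrict_words S ` ncp.span (relation_words n F)" for F :: "'k ncpoly"
    by (rule ncpp.linear_span_image[OF lin])
  have "\<exists>p. coeff_polynomial_function p \<and> p F\<^sub>0 \<noteq> 0 \<and>
    (\<forall>F. p F \<noteq> 0 \<longrightarrow> (\<forall>s\<in>S. ncmonom s \<in> ncp.span ((\<lambda>h. h F) ` (H\<^sub>1 \<union> H\<^sub>2))))"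
  proof (rule spanning_generic[OF S])
    fix h s assume "h \<in> H\<^sub>1 \<union> H\<^sub>2"
    then show "coeff_polynomial_function (\<lambda>F. Poly_Mapping.lookup (h F) s)"
      by (cases "s \<in> S")
        (auto simp: H\<^sub>1_def H\<^sub>2_def intro: coeff_polynomial_function.const
          coeff_polynomial_function_relation_word)
  next
    fix h F assume "h \<in> H\<^sub>1 \<union> H\<^sub>2"
    then show "Poly_Mapping.keys (h F) \<subseteq> S"
      using W by (auto simp: H\<^sub>1_def H\<^sub>2_def keys_ncmonom in_keys_iff split: if_splits)
  next
    fix s assume s: "s \<in> S"
    have "restrict_words S (ncmonom s) \<in>
        ncp.span (ncmonom ` W \<union> restrict_words S ` relation_words n F\<^sub>0)"
      by (rule linear_in_span[OF lin sp[OF s]])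
        (use W in \<open>auto simp: restrict_words_ncmonom intro!: ncp.span_base\<close>)
    then show "ncmonom s \<in> ncp.span ((\<lambda>h. h F\<^sub>0) ` (H\<^sub>1 \<union> H\<^sub>2))"
      using s by (simp add: img restrict_words_ncmonom)
  qed
  then obtain p where p: "coeff_polynomial_function p" "p F\<^sub>0 \<noteq> 0"
    and psp: "\<And>F s. p F \<noteq> 0 \<Longrightarrow> s \<in> S \<Longrightarrow> ncmonom s \<in> ncp.span ((\<lambda>h. h F) ` (H\<^sub>1 \<union> H\<^sub>2))"
    by blast
  show ?thesis
  proof (intro exI[of _ p] conjI allI impI ballI p)
    fix F s assume "p F \<noteq> 0" and s: "s \<in> S"
    then have "ncmonom s \<in>
        {h + g | h g. h \<in> ncp.span (ncmonom ` W) \<and> g \<in> restrict_words S ` ncp.span (relation_words n F)}"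
      using psp[of F s] s unfolding img ncp.span_Un img_span by simp
    then obtain h g where h: "h \<in> ncp.span (ncmonom ` W)" and g: "g \<in> ncp.span (relation_words n F)"
      and eq: "ncmonom s = h + restrict_words S g"
      by blast
    have "restrict_words S (ncmonom s - h - g) = 0"
    proof (rule poly_mapping_eqI)
      fix t
      have "Poly_Mapping.lookup (ncmonom s) t =
          Poly_Mapping.lookup h t + (if t \<in> S then Poly_Mapping.lookup g t else 0)"
        by (simp add: eq lookup_add)
      then show "Poly_Mapping.lookup (restrict_words S (ncmonom s - h - g)) t = Poly_Mapping.lookup 0 t"
        by (simp add: lookup_minus)
    qed
    then show "\<exists>h\<in>ncp.span (ncmonom ` W). \<exists>g\<in>ncp.span (relation_words n F).
       restrict_words S (ncmonom s - h - g) = 0"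
      using h g by blast
  qed
qed

text \<open>A dimension count: a union that spans at least as many independent vectors as
  \<open>A\<close> and \<open>B\<close> have elements together must be independent and disjoint, and
  then the two spans meet only in zero.\<close>

lemma disjoint_spans:
  fixes A B T :: "'k::field ncpoly set"
  assumes fin: "finite A" "finite B" and T: "ncp.independent T" "T \<subseteq> ncp.span (A \<union> B)"
    and card: "card A + card B \<le> card T"
    and x: "x \<in> ncp.span A" "x \<in> ncp.span B"
  shows "x = 0"
proof -
  have finT: "finite T" "card T \<le> card (A \<union> B)"
    using ncp.independent_span_bound[OF finite_UnI[OF fin] T] by blast+
  have "card (A \<union> B) = card A + card B"
    using finT(2) card card_Un_le[of A B] by linarith
  then have disj: "A \<inter> B = {}"
    using card_Un_Int[OF fin] fin by simp
  have indep: "ncp.independent (A \<union> B)"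
  proof
    assume "ncp.dependent (A \<union> B)"
    then obtain b where b: "b \<in> A \<union> B" "b \<in> ncp.span (A \<union> B - {b})"
      by (auto simp: ncp.dependent_def)
    then have "ncp.span (A \<union> B) = ncp.span (A \<union> B - {b})"
      using ncp.span_redundant[OF b(2)] insert_Diff[OF b(1)] by simp
    then have "T \<subseteq> ncp.span (A \<union> B - {b})"
      using T(2) by simp
    then have "card T \<le> card (A \<union> B - {b})"
      using ncp.independent_span_bound[OF finite_Diff[OF finite_UnI[OF fin]] T(1)] by blast
    moreover have "card (A \<union> B - {b}) < card (A \<union> B)"
      using b fin by (intro card_Diff1_less) auto
    ultimately show False using card card_Un_le[of A B] by linarith
  qed
  \<comment> \<open>Remove the elements of \<open>A\<close> one at a time. If \<open>a\<close> had a
    nonzero coefficient \<open>c\<close> in \<open>x\<close>, then \<open>nc_scale c a\<close> would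
    be a difference of two elements spanned by the remaining vectors.\<close>
  from fin(1) indep disj x(1) show ?thesis
  proof (induction A rule: finite_induct)
    case (insert a A)
    then obtain c where c: "x - nc_scale c a \<in> ncp.span A"
      by (auto simp: ncp.span_breakdown_eq)
    have a: "a \<notin> A \<union> B" using insert by auto
    have "c = 0"
    proof (rule ccontr)
      assume "c \<noteq> 0"
      have "x - (x - nc_scale c a) \<in> ncp.span (A \<union> B)"
        using c x(2) ncp.span_mono[of A "A \<union> B"] ncp.span_mono[of B "A \<union> B"]
          ncp.span_diff by blast
      then have "nc_scale (inverse c) (nc_scale c a) \<in> ncp.span (A \<union> B)"
        by (simp add: ncp.span_scale del: ncp.scale_scale)
      then have "a \<in> ncp.span (insert a A \<union> B - {a})"
        using \<open>c \<noteq> 0\<close> a by simp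
      then show False using insert.prems(1) by (auto simp: ncp.dependent_def)
    qed
    then have "x \<in> ncp.span A" using c by simp
    moreover have "ncp.independent (A \<union> B)"
      by (rule ncp.independent_mono[OF insert.prems(1)]) blast
    moreover have "A \<inter> B = {}" using insert.prems(2) by blast
    ultimately show ?case by (intro insert.IH)
  qed simp
qed

subsection \<open>Normal words\<close>

text \<open>
  The leading words of the derivatives of the special potential below; their only overlap is
  \<open>x\<^sub>n x\<^sub>2 x\<^sub>1\<^bsup>k-2\<^esup>\<close>.
\<close>

definition leading_words :: "nat \<Rightarrow> nat \<Rightarrow> nat list set" where
  "leading_words n k =
    insert (n # 2 # replicate (k - 3) 1) ((\<lambda>i. i # replicate (k - 2) 1) ` {2..n})"

definition normal_words :: "nat \<Rightarrow> nat \<Rightarrow> nat list set" where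
  "normal_words n k = {w \<in> words n. \<forall>l\<in>leading_words n k. \<not> sublist l w}"

definition normal_below :: "nat \<Rightarrow> nat \<Rightarrow> nat \<Rightarrow> nat list set" where
  "normal_below n k N = {w \<in> normal_words n k. length w < N}"

text \<open>The bound is strict so that \<open>N = 0\<close> leaves no words, which makes the
  inductions on \<open>N\<close> start trivially.\<close>

definition words_below :: "nat \<Rightarrow> nat \<Rightarrow> nat list set" where
  "words_below n N = {w \<in> words n. length w < N}"

section \<open>Words of bounded length and their number\<close>

lemma words_Cons [simp]: "i # w \<in> words n \<longleftrightarrow> i \<in> {1..n} \<and> w \<in> words n"
  by (auto simp: words_def)

lemma words_Nil [simp]: "[] \<in> words n"
  by (simp add: words_def)

lemma words_append_iff [simp]: "u @ v \<in> words n \<longleftrightarrow> u \<in> words n \<and> v \<in> words n"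
  by (auto simp: words_def)

lemma words_replicate [simp]: "1 \<le> n \<Longrightarrow> replicate a (Suc 0) \<in> words n"
  by (auto simp: words_def)

lemma finite_words_below [simp]: "finite (words_below n N)"
proof (rule finite_subset)
  show "words_below n N \<subseteq> {w. set w \<subseteq> {1..n} \<and> length w \<le> N}"
    by (auto simp: words_below_def words_def)
qed (rule finite_lists_length_le, simp)

lemma normal_below_subset: "normal_below n k N \<subseteq> words_below n N"
  by (auto simp: normal_below_def normal_words_def words_below_def)

lemma finite_normal_below [simp]: "finite (normal_below n k N)"
  using normal_below_subset finite_words_below by (rule finite_subset)

lemma words_below_0 [simp]: "words_below n 0 = {}"
  by (simp add: words_below_def)

lemma words_below_Suc:
  "words_below n (Suc N) = insert [] ((\<lambda>(i, w). i # w) ` ({1..n} \<times> words_below n N))"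
proof (intro equalityI subsetI)
  fix w assume "w \<in> words_below n (Suc N)"
  then show "w \<in> insert [] ((\<lambda>(i, w). i # w) ` ({1..n} \<times> words_below n N))"
    by (cases w) (auto simp: words_below_def)
qed (auto simp: words_below_def)

lemma card_words_below_Suc: "card (words_below n (Suc N)) = 1 + n * card (words_below n N)"
proof -
  have "card ((\<lambda>(i, w). i # w) ` ({1..n} \<times> words_below n N)) = n * card (words_below n N)"
    by (subst card_image) (auto simp: inj_on_def card_cartesian_product)
  then show ?thesis
    unfolding words_below_Suc by (subst card_insert_disjoint) auto
qed

section \<open>Closure properties of normal words and the number of leading words\<close>

lemma normal_words_Cons:
  "i # w \<in> normal_words n k \<longleftrightarrow>
    i \<in> {1..n} \<and> w \<in> normal_words n k \<and> (\<forall>l\<in>leading_words n k. \<not> prefix l (i # w))"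
  by (auto simp: normal_words_def sublist_Cons_right)

text \<open>All leading words start with a letter in \<open>{2..n}\<close>, so a new first letter 1
  cannot complete one. This is the source of the injectivity of left multiplication by
  \<open>x\<^sub>1\<close>.\<close>

lemma normal_words_Cons_1:
  assumes "n \<ge> 2"
  shows "1 # w \<in> normal_words n k \<longleftrightarrow> w \<in> normal_words n k"
  using assms by (auto simp: normal_words_Cons leading_words_def)

lemma normal_words_replicate_append:
  assumes "n \<ge> 2"
  shows "replicate a 1 @ w \<in> normal_words n k \<longleftrightarrow> w \<in> normal_words n k"
  using normal_words_Cons_1[OF assms] by (induction a) auto

lemma length_leading_words: "k \<ge> 3 \<Longrightarrow> l \<in> leading_words n k \<Longrightarrow> length l = k - 1"
  by (auto simp: leading_words_def)

lemma finite_leading_words [simp]: "finite (leading_words n k)"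
  by (simp add: leading_words_def)

lemma card_leading_words:
  assumes "n \<ge> 2" "k \<ge> 3"
  shows "card (leading_words n k) = n"
proof -
  obtain j where k: "k = Suc (Suc (Suc j))"
    using assms(2) by (metis add_2_eq_Suc le_Suc_ex numeral_3_eq_3 add_Suc)
  have "n # 2 # replicate (k - 3) 1 \<notin> (\<lambda>i. i # replicate (k - 2) 1) ` {2..n}"
    by (auto simp: k)
  moreover have "card ((\<lambda>i. i # replicate (k - 2) (1 :: nat)) ` {2..n}) = n - 1"
    by (subst card_image) (auto simp: inj_on_def)
  ultimately show ?thesis
    using assms(1) by (simp add: leading_words_def)
qed

text \<open>
  This is where the case \<open>(n, k) = (2, 3)\<close> is lost: there \<open>x\<^sub>2 x\<^sub>2\<close> is a leading word and
  overlaps itself.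
\<close>

lemma normal_words_overlap:
  assumes n: "n \<ge> 2" and k: "k \<ge> 3" and nk: "(n, k) \<noteq> (2, 3)"
    and v: "v \<in> normal_words n k" and v1: "\<And>v'. v \<noteq> 1 # v'"
  shows "2 # replicate (k - 3) 1 @ v \<in> normal_words n k"
proof -
  obtain j where j: "k = Suc (Suc (Suc j))"
    using k by (metis add_2_eq_Suc le_Suc_ex numeral_3_eq_3 add_Suc)
  have "\<not> prefix (i # replicate (k - 2) 1) (2 # replicate (k - 3) 1 @ v)" for i
  proof
    assume "prefix (i # replicate (k - 2) 1) (2 # replicate (k - 3) 1 @ v)"
    then have "prefix (replicate j 1 @ [1]) (replicate j 1 @ v)"
      by (simp add: j replicate_append_same)
    then show False using v1 by (cases v) auto
  qed
  \<comment> \<open>For \<open>k = 3\<close> the first letters differ, as then \<open>n\<close> is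
    not 2; for larger \<open>k\<close> the second letters 2 and 1 differ.\<close>
  moreover have "\<not> prefix (n # 2 # replicate (k - 3) 1) (2 # replicate (k - 3) 1 @ v)"
    using nk j by (cases j) auto
  ultimately show ?thesis
    using n normal_words_replicate_append[OF n, of "k - 3" v k] v
    unfolding normal_words_Cons leading_words_def by auto
qed

text \<open>
  The normal words and the products of a leading word with a normal word are pairwise distinct; each
  of them is a letter followed by a normal word or the overlap followed by a normal word.
\<close>

lemma card_normal_below_le:
  assumes n: "n \<ge> 2" and k: "k \<ge> 3" and nk: "(n, k) \<noteq> (2, 3)"
  shows "card (normal_below n k (Suc N)) + n * card (normal_below n k (N + 2 - k))
    \<le> 1 + n * card (normal_below n k N) + card (normal_below n k (Suc N - k))"
proof -
  let ?B = "normal_below n k"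
  define A where "A = ?B (Suc N) - {[]}"
  \<comment> \<open>Leading words have length \<open>k - 1\<close>, so the bound
    \<open>N + 2 - k\<close> on the normal factor means total length at most
    \<open>N\<close>.\<close>
  define D where "D = (\<lambda>(l, v). l @ v) ` (leading_words n k \<times> ?B (N + 2 - k))"
  define X where "X = (\<lambda>(i, w). i # w) ` ({1..n} \<times> ?B N)"
  \<comment> \<open>The overlap has length \<open>k\<close>, whence the bound
    \<open>Suc N - k\<close> on what follows it.\<close>
  define Y where "Y = (\<lambda>v. n # 2 # replicate (k - 3) 1 @ 1 # v) ` ?B (Suc N - k)"
  have fin: "finite A" "finite D" "finite X" "finite Y"
    by (simp_all add: A_def D_def X_def Y_def)
  have "A \<inter> D = {}"
    by (auto simp: A_def D_def normal_below_def normal_words_def)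
  then have AD: "card (A \<union> D) = card A + card D"
    using fin by (intro card_Un_disjoint)
  have "inj_on (\<lambda>(l, v). l @ v) (leading_words n k \<times> ?B (N + 2 - k))"
    using length_leading_words[OF k] by (auto simp: inj_on_def)
  then have D: "card D = n * card (?B (N + 2 - k))"
    unfolding D_def using card_leading_words[OF n k] by (simp add: card_image card_cartesian_product)
  have A: "card (?B (Suc N)) \<le> 1 + card A"
    unfolding A_def by (simp add: card_Diff_singleton_if) arith
  have "A \<union> D \<subseteq> X \<union> Y"
  proof
    fix w assume "w \<in> A \<union> D"
    then consider (A) "w \<in> A" | (D) "w \<in> D" by blast
    then show "w \<in> X \<union> Y"
    proof cases
      case A
      then show ?thesis
        by (cases w) (auto simp: A_def X_def normal_below_def normal_words_Cons)
    next
      case D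
      then obtain l v where w: "w = l @ v" and l: "l \<in> leading_words n k" and v: "v \<in> ?B (N + 2 - k)"
        by (auto simp: D_def)
      have vn: "v \<in> normal_words n k" and vl: "length v < N + 2 - k"
        using v by (auto simp: normal_below_def)
      have X: "i # u \<in> X" if "i \<in> {1..n}" "u \<in> normal_words n k" "length u < N" for i u
        using that by (auto simp: X_def normal_below_def)
      from l consider (i) i where "i \<in> {2..n}" "l = i # replicate (k - 2) 1"
        | (n) "l = n # 2 # replicate (k - 3) 1"
        by (auto simp: leading_words_def)
      then show ?thesis
      proof cases
        case (i i)
        have "i # replicate (k - 2) 1 @ v \<in> X"
          using i(1) vl k normal_words_replicate_append[OF n, of "k - 2" v k] vn
          by (intro X) auto
        then show ?thesis by (simp add: w i)
      next
        case n': n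
        show ?thesis
        proof (cases "\<exists>v'. v = 1 # v'")
          case True
          then obtain v' where v': "v = 1 # v'" by blast
          then have "v' \<in> ?B (Suc N - k)"
            using vn vl normal_words_Cons_1[OF n] k by (auto simp: normal_below_def)
          then show ?thesis by (auto simp: w n' v' Y_def)
        next
          case False
          then have "n # (2 # replicate (k - 3) 1 @ v) \<in> X"
            using n vl k by (intro X normal_words_overlap[OF n k nk vn]) auto
          then show ?thesis by (simp add: w n')
        qed
      qed
    qed
  qed
  then have "card (A \<union> D) \<le> card X + card Y"
    using fin by (meson card_Un_le card_mono finite_UnI le_trans)
  moreover have "card X \<le> n * card (?B N)"
    unfolding X_def by (rule order_trans[OF card_image_le]) (auto simp: card_cartesian_product)
  moreover have "card Y \<le> card (?B (Suc N - k))"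
    unfolding Y_def by (rule card_image_le) simp
  ultimately show ?thesis using AD D A by linarith
qed

subsection \<open>The special potential\<close>

text \<open>
  All rotations of the words \<open>x\<^sub>1\<^bsup>k-2\<^esup> x\<^sub>i x\<^bsub>n+2-i\<^esub>\<close>. Pairing \<open>i\<close> with \<open>n + 2 - i\<close> makes
  \<open>x\<^sub>n x\<^sub>2\<close>, and not \<open>x\<^sub>n x\<^sub>n\<close>, the leading word of the quadratic factor.
\<close>

definition special_words :: "nat \<Rightarrow> nat \<Rightarrow> nat list set" where
  "special_words n k =
    {replicate a 1 @ [i, n + 2 - i] @ replicate b 1 | a b i. a + b = k - 2 \<and> i \<in> {2..n}} \<union>
    {i # replicate (k - 2) 1 @ [n + 2 - i] | i. i \<in> {2..n}}"

definition special_potential :: "nat \<Rightarrow> nat \<Rightarrow> 'k::field ncpoly" where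
  "special_potential n k = (\<Sum>u\<in>special_words n k. ncmonom u)"

lemma special_words_subset:
  assumes "n \<ge> 2" "k \<ge> 3"
  shows "special_words n k \<subseteq> {u \<in> words n. length u = k}"
  using assms by (auto simp: special_words_def)

lemma finite_special_words:
  assumes "n \<ge> 2" "k \<ge> 3"
  shows "finite (special_words n k)"
proof (rule finite_subset)
  show "special_words n k \<subseteq> words_below n (Suc k)"
    using special_words_subset[OF assms] by (auto simp: words_below_def)
qed simp

text \<open>Rotation is injective and the set is finite, so mapping into the set suffices. Rotating
  the pair apart and then together again interchanges \<open>i\<close> and \<open>n + 2 - i\<close>,
  a reflection of \<open>{2..n}\<close>.\<close>

lemma rotate1_special_words:
  assumes "n \<ge> 2" "k \<ge> 3"
  shows "rotate1 ` special_words n k = special_words n k"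
proof (rule endo_inj_surj)
  show "finite (special_words n k)" by (rule finite_special_words[OF assms])
  show "inj_on rotate1 (special_words n k)"
    using inj_rotate1 by (rule inj_on_subset) simp
  show "rotate1 ` special_words n k \<subseteq> special_words n k"
  proof
    fix w assume "w \<in> rotate1 ` special_words n k"
    then obtain u where w: "w = rotate1 u" and u: "u \<in> special_words n k" by blast
    from u consider (a) a b i where "a + b = k - 2" "i \<in> {2..n}"
        "u = replicate a 1 @ [i, n + 2 - i] @ replicate b 1"
      | (b) i where "i \<in> {2..n}" "u = i # replicate (k - 2) 1 @ [n + 2 - i]"
      unfolding special_words_def by blast
    then show "w \<in> special_words n k"
    proof cases
      case (a a b i)
      show ?thesis
      proof (cases a)
        case 0
        have "n + 2 - (n + 2 - i) = i" "n + 2 - i \<in> {2..n}" using a(2) by auto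
        moreover have "w = (n + 2 - i) # replicate (k - 2) 1 @ [i]"
          using a 0 by (simp add: w)
        ultimately show ?thesis
          unfolding special_words_def by (intro UnI2 CollectI exI[of _ "n + 2 - i"]) simp
      next
        case (Suc a')
        have "w = replicate a' 1 @ [i, n + 2 - i] @ replicate (Suc b) 1"
          using a Suc by (simp add: w replicate_append_same)
        moreover have "a' + Suc b = k - 2" using a Suc by simp
        ultimately show ?thesis
          using a(2) unfolding special_words_def
          by (intro UnI1 CollectI exI[of _ a'] exI[of _ "Suc b"] exI[of _ i]) simp
      qed
    next
      case (b i)
      have "n + 2 - (n + 2 - i) = i" "n + 2 - i \<in> {2..n}" using b(1) by auto
      moreover have "w = replicate (k - 2) 1 @ [n + 2 - i, i] @ replicate 0 1"
        by (simp add: w b)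
      ultimately show ?thesis
        unfolding special_words_def
        by (intro UnI1 CollectI exI[of _ "k - 2"] exI[of _ 0] exI[of _ "n + 2 - i"]) simp
    qed
  qed
qed

section \<open>The special potential, its leading terms and rewriting to normal words\<close>

lemma lookup_special_potential:
  assumes "n \<ge> 2" "k \<ge> 3"
  shows "Poly_Mapping.lookup (special_potential n k) u = (if u \<in> special_words n k then 1 else 0)"
  using finite_special_words[OF assms]
  by (simp add: special_potential_def lookup_sum lookup_ncmonom)

lemma keys_special_potential:
  assumes "n \<ge> 2" "k \<ge> 3"
  shows "Poly_Mapping.keys (special_potential n k :: 'k::field ncpoly) = special_words n k"
  by (auto simp: in_keys_iff lookup_special_potential[OF assms] split: if_splits)

lemma special_potential_in:
  assumes "n \<ge> 2" "k \<ge> 3" "m \<ge> k"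
  shows "(special_potential n k :: 'k::field ncpoly) \<in> potential_space n k m"
proof -
  let ?F = "special_potential n k :: 'k ncpoly"
  note n = assms(1,2)
  have "cyc_rotate ?F = (\<Sum>u\<in>special_words n k. ncmonom (rotate1 u))"
    unfolding cyc_rotate_def keys_special_potential[OF n] ncmonom_def
    by (simp add: lookup_special_potential[OF n])
  also have "\<dots> = (\<Sum>u\<in>rotate1 ` special_words n k. ncmonom u)"
    by (subst sum.reindex) (auto intro: inj_on_subset[OF inj_rotate1])
  also have "\<dots> = ?F"
    unfolding rotate1_special_words[OF n] special_potential_def ..
  finally have "cyc_rotate ?F = ?F" .
  moreover have "hom_component j ?F = 0" if "j < k \<or> j > m" for j
    using special_words_subset[OF n] that assms(3)
    by (intro poly_mapping_eqI) (auto simp: lookup_hom_component lookup_special_potential[OF n])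
  ultimately show ?thesis
    using special_words_subset[OF n]
    by (auto simp: potential_space_def potentials_def free_algebra_def keys_special_potential[OF n])
qed

text \<open>The derivative by letter 1 has leading word \<open>n # 2 # replicate (k - 3) 1\<close>;
  the one by \<open>n + 2 - i\<close> has \<open>i # replicate (k - 2) 1\<close>. All monomials of a
  derivative have equal length, and their first letters already decide which is largest.\<close>

lemma special_potential_leading:
  assumes n: "n \<ge> 2" and k: "k \<ge> 3" and l: "l \<in> leading_words n k"
  obtains j where "j \<in> {1..n}" "j # l \<in> special_words n k"
    "\<And>l'. j # l' \<in> special_words n k \<Longrightarrow> l' \<noteq> l \<Longrightarrow> length l' = length l \<and> hd l' < hd l"
proof -
  have len: "length l' = k - 1" if "j # l' \<in> special_words n k" for j l'
    using special_words_subset[OF n k] that by auto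
  have lenl: "length l = k - 1" by (rule length_leading_words[OF k l])
  obtain d where d: "k = Suc (Suc (Suc d))"
    using k by (metis add_2_eq_Suc le_Suc_ex numeral_3_eq_3 add_Suc)
  from l consider (n) "l = n # 2 # replicate d 1"
    | (i) i where "i \<in> {2..n}" "l = i # replicate (Suc d) 1"
    by (auto simp: leading_words_def d)
  then show ?thesis
  proof cases
    case n': n
    have "1 # l = replicate 1 1 @ [n, n + 2 - n] @ replicate d 1" "1 + d = k - 2"
      by (simp_all add: n' d)
    then have mem: "1 # l \<in> special_words n k"
      using n unfolding special_words_def
      by (intro UnI1 CollectI exI[of _ 1] exI[of _ d] exI[of _ n]) simp
    have less: "hd l' < hd l" if "1 # l' \<in> special_words n k" "l' \<noteq> l" for l'
    proof -
      from that(1) consider (a) a b i where "a + b = k - 2" "i \<in> {2..n}"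
          "1 # l' = replicate a 1 @ [i, n + 2 - i] @ replicate b 1"
        | (b) i where "i \<in> {2..n}" "1 # l' = i # replicate (k - 2) 1 @ [n + 2 - i]"
        unfolding special_words_def by blast
      then show ?thesis
      proof cases
        case (a a b i)
        then obtain a' where a': "a = Suc a'" by (cases a) auto
        show ?thesis
        proof (cases a')
          case 0
          then have "l' = i # (n + 2 - i) # replicate d 1" using a a' d by simp
          with that(2) a(2) n' show ?thesis by (cases "i = n") auto
        next
          case (Suc c)
          then show ?thesis using a a' n n' by simp
        qed
      qed auto
    qed
    show ?thesis
      by (rule that[of 1]) (use mem less n len lenl in auto)
  next
    case (i i)
    let ?j = "n + 2 - i"
    have j: "?j \<in> {2..n}" "n + 2 - ?j = i" using i by auto
    have "?j # l = replicate 0 1 @ [?j, n + 2 - ?j] @ replicate (Suc d) 1" "0 + Suc d = k - 2"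
      unfolding j by (simp_all add: i d)
    then have mem: "?j # l \<in> special_words n k"
      using j(1) unfolding special_words_def
      by (intro UnI1 CollectI exI[of _ 0] exI[of _ "Suc d"] exI[of _ ?j] conjI)
    have less: "hd l' < hd l" if "?j # l' \<in> special_words n k" "l' \<noteq> l" for l'
    proof -
      from that(1) consider (a) a b c where "a + b = k - 2" "c \<in> {2..n}"
          "?j # l' = replicate a 1 @ [c, n + 2 - c] @ replicate b 1"
        | (b) c where "c \<in> {2..n}" "?j # l' = c # replicate (k - 2) 1 @ [n + 2 - c]"
        unfolding special_words_def by blast
      then show ?thesis
      proof cases
        case (a a b c)
        then have "a = 0" using j(1) by (cases a) auto
        then have "l' = l" using a i d by auto
        with that(2) show ?thesis by simp
      next
        case (b c)
        then show ?thesis using i d by simp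
      qed
    qed
    show ?thesis
      by (rule that[of ?j]) (use mem less j len lenl in auto)
  qed
qed

text \<open>Rewriting: a leading factor is traded for lexicographically smaller words of the same
  length. The order \<open>lex\<close> compares only words of equal length, so the rewriting
  terminates.\<close>

lemma special_potential_spanning:
  assumes n: "n \<ge> 2" and k: "k \<ge> 3" and v: "v \<in> words n"
  shows "ncmonom v \<in> ncp.span (ncmonom ` {w \<in> normal_words n k. length w = length v} \<union>
    relation_words n (special_potential n k :: 'k::field ncpoly))"
proof -
  let ?F = "special_potential n k :: 'k ncpoly"
  let ?V = "\<lambda>N. ncp.span (ncmonom ` {w \<in> normal_words n k. length w = N} \<union> relation_words n ?F)"
  have "wf (lex {(a :: nat, b). a < b})"
    by (rule wf_lex) (rule wf)
  then show ?thesis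
    using v
  proof (induction v rule: wf_induct_rule)
    case (less v)
    show ?case
    proof (cases "v \<in> normal_words n k")
      case True
      then show ?thesis by (intro ncp.span_base) auto
    next
      case False
      then obtain l a b where l: "l \<in> leading_words n k" and v: "v = a @ l @ b"
        using less.prems by (auto simp: normal_words_def sublist_def)
      obtain j where j: "j \<in> {1..n}" "j # l \<in> special_words n k"
        and lower: "\<And>l'. j # l' \<in> special_words n k \<Longrightarrow> l' \<noteq> l \<Longrightarrow>
          length l' = length l \<and> hd l' < hd l"
        by (rule special_potential_leading[OF n k l]) blast
      have ab: "a \<in> words n" "b \<in> words n" using less.prems v by auto
      \<comment> \<open>The leading coefficient is 1, so modulo the relation \<open>l\<close>
        becomes \<open>- r\<close>, whose words all have a smaller first letter.\<close>
      define r where "r = nc_deriv j ?F - ncmonom l"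
      let ?K = "{l'. j # l' \<in> special_words n k \<and> l' \<noteq> l}"
      have "Poly_Mapping.keys r \<subseteq> ?K"
        using j(2)
        by (auto simp: r_def in_keys_iff lookup_minus lookup_nc_deriv lookup_ncmonom
            lookup_special_potential[OF n k] split: if_splits)
      then have r: "r \<in> ncp.span (ncmonom ` ?K)" by (rule keys_subset_imp_span)
      have "ncmonom a * (r * ncmonom b) \<in> ?V (length v)"
      proof (rule linear_in_span[OF linear_mult_left])
        show "r * ncmonom b \<in> ncp.span ((\<lambda>l'. ncmonom (l' @ b)) ` ?K)"
          by (rule linear_in_span[OF linear_mult_right r])
            (auto simp: ncmonom_mult intro!: ncp.span_base)
      next
        fix x :: "'k ncpoly" assume "x \<in> (\<lambda>l'. ncmonom (l' @ b)) ` ?K"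
        then obtain l' where x: "x = ncmonom (l' @ b)" and l': "j # l' \<in> special_words n k" "l' \<noteq> l"
          by blast
        have len: "length l' = length l" and hd: "hd l' < hd l" using lower[OF l'] by auto
        have "l \<noteq> []" using length_leading_words[OF k l] k by auto
        then have "(l', l) \<in> lex {(a, b). a < b}"
          using len hd by (cases l; cases l') auto
        then have lex: "(a @ l' @ b, v) \<in> lex {(a, b). a < b}"
          unfolding v by (intro lex_append_leftI lex_append_rightI) (use len in auto)
        have "a @ l' @ b \<in> words n"
          using special_words_subset[OF n k] l' ab by auto
        from less.IH[OF lex this] show "ncmonom a * x \<in> ?V (length v)"
          using len by (simp add: x v ncmonom_mult)
      qed
      moreover have "ncmonom a * nc_deriv j ?F * ncmonom b \<in> ?V (length v)"
        using relation_wordsI[OF ab(1) j(1) ab(2)] by (intro ncp.span_base) blast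
      moreover have "ncmonom v = ncmonom a * nc_deriv j ?F * ncmonom b - ncmonom a * (r * ncmonom b)"
        by (simp add: v r_def algebra_simps ncmonom_mult)
      ultimately show ?thesis by (simp add: ncp.span_diff)
    qed
  qed
qed

subsection \<open>Normal words form a basis of the truncated potential algebra\<close>

text \<open>Spanning by normal words modulo the relations and modulo words of length at least
  \<open>N\<close>. For each \<open>N\<close> this concerns finitely many words, which is what makes
  it an open condition on \<open>F\<close>.\<close>

definition normal_spanning :: "nat \<Rightarrow> nat \<Rightarrow> 'k::field ncpoly \<Rightarrow> nat \<Rightarrow> bool" where
  "normal_spanning n k F N \<longleftrightarrow>
    (\<forall>s\<in>words_below n N. \<exists>h\<in>ncp.span (ncmonom ` normal_below n k N).
      \<exists>g\<in>ncp.span (relation_words n F). restrict_words (words_below n N) (ncmonom s - h - g) = 0)"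

lemma restrict_words_letter_mult:
  assumes "j \<in> {1..n}"
  shows "restrict_words (words_below n (Suc N)) (ncmonom [j] * g) =
    ncmonom [j] * restrict_words (words_below n N) g"
proof (rule poly_mapping_eqI)
  fix w
  show "Poly_Mapping.lookup (restrict_words (words_below n (Suc N)) (ncmonom [j] * g)) w =
    Poly_Mapping.lookup (ncmonom [j] * restrict_words (words_below n N) g) w"
    using assms by (cases w) (auto simp: lookup_ncmonom_mult words_below_def)
qed

lemma keys_potential:
  fixes F :: "'k::field ncpoly"
  assumes "F \<in> potential_space n k m"
  shows "Poly_Mapping.keys F \<subseteq> {u \<in> words n. k \<le> length u}"
proof
  fix u assume u: "u \<in> Poly_Mapping.keys F"
  have "k \<le> length u"
  proof (rule ccontr)
    assume "\<not> k \<le> length u"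
    then have "hom_component (length u) F = 0"
      using assms by (simp add: potential_space_def)
    then have "Poly_Mapping.lookup (hom_component (length u) F) u = 0" by simp
    then show False using u by (simp add: lookup_hom_component in_keys_iff)
  qed
  then show "u \<in> {u \<in> words n. k \<le> length u}"
    using assms u by (auto simp: potential_space_def potentials_def free_algebra_def)
qed

text \<open>Extends the spanning property by linearity to every element of the algebra; words of
  length at least \<open>N\<close> vanish under truncation.\<close>

lemma normal_spanning_keys:
  fixes F f :: "'k::field ncpoly"
  assumes sp: "normal_spanning n k F N" and f: "Poly_Mapping.keys f \<subseteq> words n"
  obtains h g where "h \<in> ncp.span (ncmonom ` normal_below n k N)"
    "g \<in> ncp.span (relation_words n F)" "restrict_words (words_below n N) (f - h - g) = 0"
proof -
  let ?r = "restrict_words (words_below n N) :: 'k ncpoly \<Rightarrow> _"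
  have "f \<in> ncp.span (ncmonom ` words n)" using f by (rule keys_subset_imp_span)
  then have "\<exists>h\<in>ncp.span (ncmonom ` normal_below n k N).
    \<exists>g\<in>ncp.span (relation_words n F). ?r (f - h - g) = 0"
  proof (induction rule: ncp.span_induct_alt)
    case base
    show ?case
      by (intro bexI[of _ 0] ncp.span_zero) (simp add: restrict_words_eq_0_iff)
  next
    case (step c x y)
    then obtain s where s: "x = ncmonom s" "s \<in> words n" by blast
    have "\<exists>h\<in>ncp.span (ncmonom ` normal_below n k N).
      \<exists>g\<in>ncp.span (relation_words n F). ?r (x - h - g) = 0"
    proof (cases "s \<in> words_below n N")
      case True
      then show ?thesis using sp s by (auto simp: normal_spanning_def)
    next
      case False
      then show ?thesis
        by (intro bexI[of _ 0] ncp.span_zero) (simp add: restrict_words_eq_0_iff s keys_ncmonom)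
    qed
    then obtain h1 g1 where 1: "h1 \<in> ncp.span (ncmonom ` normal_below n k N)"
      "g1 \<in> ncp.span (relation_words n F)" "?r (x - h1 - g1) = 0" by blast
    from step.IH obtain h2 g2 where 2: "h2 \<in> ncp.span (ncmonom ` normal_below n k N)"
      "g2 \<in> ncp.span (relation_words n F)" "?r (y - h2 - g2) = 0" by blast
    have "?r (nc_scale c x + y - (nc_scale c h1 + h2) - (nc_scale c g1 + g2)) =
        nc_scale c (?r (x - h1 - g1)) + ?r (y - h2 - g2)"
      by (rule poly_mapping_eqI) (simp add: lookup_add lookup_minus algebra_simps)
    then have "?r (nc_scale c x + y - (nc_scale c h1 + h2) - (nc_scale c g1 + g2)) = 0"
      by (simp add: 1 2)
    moreover have "nc_scale c h1 + h2 \<in> ncp.span (ncmonom ` normal_below n k N)"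
      by (rule ncp.span_add[OF ncp.span_scale[OF 1(1)] 2(1)])
    moreover have "nc_scale c g1 + g2 \<in> ncp.span (relation_words n F)"
      by (rule ncp.span_add[OF ncp.span_scale[OF 1(2)] 2(2)])
    ultimately show ?case by blast
  qed
  then show ?thesis using that by blast
qed

text \<open>
  The syzygy \<open>\<Sum>x\<^sub>i \<delta>\<^sub>i F = \<Sum>\<delta>\<^sub>i F x\<^sub>i\<close> makes the generators
  \<open>\<delta>\<^sub>1 F x\<^sub>1 w\<close> redundant.
\<close>

lemma relations_spanning_step:
  fixes F :: "'k::field ncpoly"
  assumes n: "n \<ge> 2" and k: "k \<ge> 3" and F: "F \<in> potential_space n k m"
    and sp: "normal_spanning n k F (N + 2 - k)"
    and S: "\<And>g. g \<in> ncp.span (relation_words n F) \<Longrightarrow> restrict_words (words_below n N) g \<in> ncp.span S"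
    and S'1: "\<And>j s. j \<in> {1..n} \<Longrightarrow> s \<in> S \<Longrightarrow> ncmonom [j] * s \<in> S'"
    and S'2: "\<And>i w. i \<in> {1..n} \<Longrightarrow> w \<in> normal_below n k (N + 2 - k) \<Longrightarrow> i \<noteq> 1 \<or> (\<forall>w'. w \<noteq> 1 # w') \<Longrightarrow>
      restrict_words (words_below n (Suc N)) (nc_deriv i F * ncmonom w) \<in> S'"
    and g: "g \<in> ncp.span (relation_words n F)"
  shows "restrict_words (words_below n (Suc N)) g \<in> ncp.span S'"
proof -
  let ?r = "restrict_words (words_below n (Suc N)) :: 'k ncpoly \<Rightarrow> _"
  let ?I = "ncp.span (relation_words n F)"
  let ?K = "{u \<in> words n. k - 1 \<le> length u}"
  note keysF = keys_potential[OF F]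
  have keysF': "Poly_Mapping.keys F \<subseteq> words n" "[] \<notin> Poly_Mapping.keys F"
    using keysF k by auto
  have rot: "cyc_rotate F = F" using F by (simp add: potential_space_def potentials_def)
  interpret I: ideal ?I "free_algebra n :: 'k ncpoly ring"
    by (rule potential_ideal_eq_span(1)[OF keysF'(1)])
  have lin: "Vector_Spaces.linear nc_scale nc_scale (\<lambda>x. ?r (f * x))" for f
    using Vector_Spaces.linear_compose[OF linear_mult_left[of f] linear_restrict_words]
    by (simp add: comp_def)
  have lin': "Vector_Spaces.linear nc_scale nc_scale (\<lambda>x. ?r (x * f))" for f
    using Vector_Spaces.linear_compose[OF linear_mult_right[of f] linear_restrict_words]
    by (simp add: comp_def)
  \<comment> \<open>\<open>S\<close> covers the truncated ideal below length \<open>N\<close>, and a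
    letter in front raises the length by one.\<close>
  have letter: "?r (ncmonom [j] * x) \<in> ncp.span S'" if "j \<in> {1..n}" "x \<in> ?I" for j x
    unfolding restrict_words_letter_mult[OF that(1)]
    by (rule linear_in_span[OF linear_mult_left S[OF that(2)]])
      (rule ncp.span_base, rule S'1[OF that(1)])
  have keysd: "Poly_Mapping.keys (nc_deriv i F) \<subseteq> ?K" for i
  proof
    fix u assume "u \<in> Poly_Mapping.keys (nc_deriv i F)"
    then have "i # u \<in> Poly_Mapping.keys F" by (simp add: in_keys_iff lookup_nc_deriv)
    then show "u \<in> ?K" using keysF by auto
  qed
  \<comment> \<open>Every word of a derivative is nonempty; splitting off its first letter leaves an
    element of the ideal, so \<open>letter\<close> applies.\<close>
  have ideal: "?r (nc_deriv i F * x) \<in> ncp.span S'" if x: "x \<in> ?I" for i x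
  proof (rule linear_in_span[OF lin' keys_subset_imp_span[OF keysd]])
    fix a :: "'k ncpoly" assume "a \<in> ncmonom ` ?K"
    then obtain u where u: "a = ncmonom u" "u \<in> ?K" by blast
    then obtain j u' where u': "u = j # u'" using k by (cases u) auto
    then have j: "j \<in> {1..n}" "u' \<in> words n" using u by auto
    have "ncmonom u' * x \<in> ?I"
      using I.I_l_closed[OF x, of "ncmonom u'"] j by (simp add: free_algebra_def keys_ncmonom)
    from letter[OF j(1) this] show "?r (a * x) \<in> ncp.span S'"
      by (simp add: u u' mult.assoc[symmetric] ncmonom_mult)
  qed
  \<comment> \<open>Derivatives contain only words of length at least \<open>k - 1\<close>, so right
    factors of length \<open>N + 2 - k\<close> or more push the product beyond length
    \<open>N\<close>.\<close>
  have high: "?r (nc_deriv i F * f) = 0"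
    if "restrict_words (words_below n (N + 2 - k)) f = 0" "Poly_Mapping.keys f \<subseteq> words n" for i f
    unfolding restrict_words_eq_0_iff
  proof (intro equalityI subsetI)
    fix w assume w: "w \<in> Poly_Mapping.keys (nc_deriv i F * f) \<inter> words_below n (Suc N)"
    then obtain a b where "w = a @ b" "a \<in> Poly_Mapping.keys (nc_deriv i F)"
      "b \<in> Poly_Mapping.keys f"
      using keys_mult[of "nc_deriv i F" f] by (auto simp: plus_list_def)
    moreover from this have "\<not> length b < N + 2 - k"
      using that by (auto simp: restrict_words_eq_0_iff words_below_def)
    moreover have "k - 1 \<le> length a" using calculation keysd by blast
    ultimately show "w \<in> {}" using w k by (auto simp: words_below_def)
  qed simp
  \<comment> \<open>The right factor \<open>s\<close> is replaced by normal words, an ideal element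
    and long words; the last two are covered by \<open>ideal\<close> and
    \<open>high\<close>.\<close>
  have word: "?r (nc_deriv i F * ncmonom s) \<in> ncp.span S'"
    if s: "s \<in> words n" and i: "\<And>w. w \<in> normal_below n k (N + 2 - k) \<Longrightarrow>
      ?r (nc_deriv i F * ncmonom w) \<in> ncp.span S'" for i s
  proof -
    have "Poly_Mapping.keys (ncmonom s :: 'k ncpoly) \<subseteq> words n" using s by (simp add: keys_ncmonom)
    then obtain h x where h: "h \<in> ncp.span (ncmonom ` normal_below n k (N + 2 - k))" and x: "x \<in> ?I"
      and z: "restrict_words (words_below n (N + 2 - k)) (ncmonom s - h - x) = 0"
      by (rule normal_spanning_keys[OF sp])
    have "Poly_Mapping.keys x \<subseteq> words n"
      using I.a_subset x by (auto simp: free_algebra_def)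
    moreover have "Poly_Mapping.keys h \<subseteq> words n"
      using h normal_below_subset[of n k] by (auto simp: span_ncmonom words_below_def)
    ultimately have "ncmonom s - h - x \<in> ncp.span (ncmonom ` words n)"
      using s by (intro ncp.span_diff) (auto simp: span_ncmonom keys_ncmonom)
    then have "Poly_Mapping.keys (ncmonom s - h - x) \<subseteq> words n"
      by (simp add: span_ncmonom)
    then have "?r (nc_deriv i F * (ncmonom s - h - x)) = 0"
      by (rule high[OF z])
    moreover have "?r (nc_deriv i F * ncmonom s) =
        ?r (nc_deriv i F * (ncmonom s - h - x)) + ?r (nc_deriv i F * h) + ?r (nc_deriv i F * x)"
      by (rule poly_mapping_eqI) (simp add: lookup_add lookup_minus algebra_simps)
    moreover have "?r (nc_deriv i F * h) \<in> ncp.span S'"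
      by (rule linear_in_span[OF lin h]) (use i in auto)
    ultimately show ?thesis
      using ideal[OF x, of i] by (simp add: ncp.span_add)
  qed
  have other: "?r (nc_deriv i F * ncmonom s) \<in> ncp.span S'"
    if "i \<in> {1..n}" "i \<noteq> 1" "s \<in> words n" for i s
    by (rule word[OF that(3)]) (rule ncp.span_base, rule S'2, use that in auto)
  have deriv_I: "nc_deriv j F * ncmonom w \<in> ?I" if "j \<in> {1..n}" "w \<in> words n" for j w
    using relation_wordsI[OF words_Nil that, of F] by (intro ncp.span_base) (simp add: ncmonom_Nil)
  \<comment> \<open>The syzygy times \<open>w\<close> is solved for its term with letter 1: the
    other right-hand products fall under \<open>other\<close>, and the left-hand sum consists of
    letters times ideal elements.\<close>
  have one: "?r (nc_deriv 1 F * ncmonom (1 # w)) \<in> ncp.span S'" if w: "w \<in> words n" for w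
  proof -
    have "(\<Sum>j\<in>{1..n}. nc_deriv j F * ncmonom (j # w)) =
        (\<Sum>j\<in>{1..n}. nc_deriv j F * ncmonom [j]) * ncmonom w"
      by (simp add: sum_distrib_right mult.assoc ncmonom_mult)
    also have "\<dots> = (\<Sum>j\<in>{1..n}. ncmonom [j] * nc_deriv j F) * ncmonom w"
      by (simp only: euler_left[OF keysF'] euler_right[OF keysF'] rot)
    also have "\<dots> = (\<Sum>j\<in>{1..n}. ncmonom [j] * (nc_deriv j F * ncmonom w))"
      by (simp add: sum_distrib_right mult.assoc)
    finally have "nc_deriv 1 F * ncmonom (1 # w) =
        (\<Sum>j\<in>{1..n}. ncmonom [j] * (nc_deriv j F * ncmonom w)) -
        (\<Sum>j\<in>{1..n}-{1}. nc_deriv j F * ncmonom (j # w))"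
      using n by (subst (asm) sum.remove[of _ 1]) (auto simp: algebra_simps)
    then have "?r (nc_deriv 1 F * ncmonom (1 # w)) =
        (\<Sum>j\<in>{1..n}. ?r (ncmonom [j] * (nc_deriv j F * ncmonom w))) -
        (\<Sum>j\<in>{1..n}-{1}. ?r (nc_deriv j F * ncmonom (j # w)))"
      by (simp add: poly_mapping_eq_iff fun_eq_iff lookup_sum lookup_minus)
    moreover have "(\<Sum>j\<in>{1..n}. ?r (ncmonom [j] * (nc_deriv j F * ncmonom w))) \<in> ncp.span S'"
      by (rule ncp.span_sum) (rule letter, assumption, rule deriv_I, assumption, rule w)
    moreover have "(\<Sum>j\<in>{1..n}-{1}. ?r (nc_deriv j F * ncmonom (j # w))) \<in> ncp.span S'"
      by (rule ncp.span_sum) (rule other, use w in auto)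
    ultimately show ?thesis by (simp add: ncp.span_diff)
  qed
  have first: "?r (nc_deriv 1 F * ncmonom s) \<in> ncp.span S'" if "s \<in> words n" for s
  proof (rule word[OF that])
    fix w assume w: "w \<in> normal_below n k (N + 2 - k)"
    then have wn: "w \<in> words n" by (simp add: normal_below_def normal_words_def)
    show "?r (nc_deriv 1 F * ncmonom w) \<in> ncp.span S'"
    proof (cases "\<exists>w'. w = 1 # w'")
      case True
      then show ?thesis using one wn by auto
    next
      case False
      then show ?thesis using n w by (intro ncp.span_base S'2) auto
    qed
  qed
  show ?thesis
  proof (rule linear_in_span[OF linear_restrict_words g])
    fix a assume "a \<in> relation_words n F"
    then obtain u i v where a: "a = ncmonom u * nc_deriv i F * ncmonom v"
      and uv: "u \<in> words n" "i \<in> {1..n}" "v \<in> words n"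
      by (auto simp: relation_words_def)
    show "?r a \<in> ncp.span S'"
    proof (cases u)
      case Nil
      then show ?thesis
        using first[OF uv(3)] other[OF uv(2) _ uv(3)] by (cases "i = 1") (simp_all add: a ncmonom_Nil)
    next
      case (Cons j u')
      have "ncmonom u' * nc_deriv i F * ncmonom v \<in> ?I"
        using uv Cons by (intro ncp.span_base relation_wordsI) auto
      from letter[OF _ this, of j] show ?thesis
        using uv Cons by (simp add: a mult.assoc[symmetric] ncmonom_mult)
    qed
  qed
qed

text \<open>Induction on \<open>N\<close>. The new generators are letters times old ones and
  truncated products of a derivative with a normal word, without those made redundant by the syzygy.
  Their number and \<open>card_normal_below_le\<close> add up to the recursion for the number of all
  words.\<close>

lemma relations_spanning_set:
  fixes F :: "'k::field ncpoly"
  assumes n: "n \<ge> 2" and k: "k \<ge> 3" and nk: "(n, k) \<noteq> (2, 3)"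
    and F: "F \<in> potential_space n k m" and sp: "\<And>N. normal_spanning n k F N"
  shows "\<exists>S. finite S \<and> card S + card (normal_below n k N) \<le> card (words_below n N) \<and>
    (\<forall>g\<in>ncp.span (relation_words n F). restrict_words (words_below n N) g \<in> ncp.span S)"
proof (induction N)
  case 0
  have "restrict_words {} g = 0" for g :: "'k ncpoly"
    by (simp add: restrict_words_eq_0_iff)
  then show ?case
    using normal_below_subset[of n k 0] by (intro exI[of _ "{}"]) auto
next
  case (Suc N)
  then obtain S where S: "finite S" "card S + card (normal_below n k N) \<le> card (words_below n N)"
    and Sspan: "\<And>g. g \<in> ncp.span (relation_words n F) \<Longrightarrow>
      restrict_words (words_below n N) g \<in> ncp.span S" by blast
  let ?r = "restrict_words (words_below n (Suc N)) :: 'k ncpoly \<Rightarrow> _"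
  let ?B = "normal_below n k (N + 2 - k)" and ?C = "(#) 1 ` normal_below n k (Suc N - k)"
  define S1 where "S1 = (\<lambda>(j, s). ncmonom [j] * s) ` ({1..n} \<times> S)"
  define R where "R = {1..n} \<times> ?B - {1} \<times> ?C"
  define S2 where "S2 = (\<lambda>(i, w). ?r (nc_deriv i F * ncmonom w)) ` R"
  have C: "?C \<subseteq> ?B"
    using normal_words_Cons_1[OF n] by (auto simp: normal_below_def)
  have "card ({1} \<times> ?C) = card (normal_below n k (Suc N - k))"
    by (simp add: card_image)
  then have R: "card R = n * card ?B - card (normal_below n k (Suc N - k))"
    unfolding R_def using C n by (subst card_Diff_subset) auto
  have "card (S1 \<union> S2) \<le> card S1 + card S2" by (rule card_Un_le)
  moreover have "card S1 \<le> n * card S"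
    unfolding S1_def using card_image_le[of "{1..n} \<times> S"] S by (simp add: card_cartesian_product)
  moreover have "card S2 \<le> card R"
    unfolding S2_def by (rule card_image_le) (simp add: R_def)
  ultimately have "card (S1 \<union> S2) \<le> n * card S + (n * card ?B - card (normal_below n k (Suc N - k)))"
    using R by linarith
  \<comment> \<open>The size of \<open>R\<close> is a difference of naturals; this bound makes it an
    exact subtraction.\<close>
  moreover have "card (normal_below n k (Suc N - k)) \<le> n * card ?B"
  proof -
    have "card (normal_below n k (Suc N - k)) \<le> card ?B"
      using card_mono[OF finite_normal_below C] by (simp add: card_image)
    also have "\<dots> \<le> n * card ?B" using n by simp
    finally show ?thesis .
  qed
  moreover have "n * card S + n * card (normal_below n k N) \<le> n * card (words_below n N)"
    using S(2) by (simp add: add_mult_distrib2[symmetric])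
  ultimately have "card (S1 \<union> S2) + card (normal_below n k (Suc N)) \<le> card (words_below n (Suc N))"
    using card_normal_below_le[OF n k nk, of N] card_words_below_Suc[of n N] by linarith
  moreover have "?r g \<in> ncp.span (S1 \<union> S2)" if "g \<in> ncp.span (relation_words n F)" for g
  proof (rule relations_spanning_step[OF n k F sp Sspan _ _ that])
    fix j s assume "j \<in> {1..n}" "s \<in> S"
    then show "ncmonom [j] * s \<in> S1 \<union> S2" by (auto simp: S1_def)
  next
    fix i w assume "i \<in> {1..n}" "w \<in> ?B" "i \<noteq> 1 \<or> (\<forall>w'. w \<noteq> 1 # w')"
    then have "(i, w) \<in> R" by (auto simp: R_def)
    then show "?r (nc_deriv i F * ncmonom w) \<in> S1 \<union> S2"
      unfolding S2_def by (intro UnI2 image_eqI[of _ _ "(i, w)"]) auto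
  qed
  moreover have "finite (S1 \<union> S2)" using S by (simp add: S1_def S2_def R_def)
  ultimately show ?case by blast
qed

text \<open>Below length \<open>N\<close>, the normal words and the small spanning set of the ideal
  together span all words without exceeding their number, so \<open>disjoint_spans\<close> applies;
  \<open>h\<close> lies in both spans since it agrees with \<open>g\<close> there.\<close>

lemma normal_words_independent:
  fixes F h :: "'k::field ncpoly"
  assumes n: "n \<ge> 2" and k: "k \<ge> 3" and nk: "(n, k) \<noteq> (2, 3)"
    and F: "F \<in> potential_space n k m" and sp: "\<And>N. normal_spanning n k F N"
    and h: "h \<in> ncp.span (ncmonom ` normal_below n k N)"
    and g: "g \<in> ncp.span (relation_words n F)"
    and eq: "restrict_words (words_below n N) (h - g) = 0"
  shows "h = 0"
proof -
  let ?r = "restrict_words (words_below n N) :: 'k ncpoly \<Rightarrow> _"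
  let ?W = "ncmonom ` normal_below n k N :: 'k ncpoly set"
  obtain S where S: "finite S" "card S + card (normal_below n k N) \<le> card (words_below n N)"
    and Sspan: "\<And>g. g \<in> ncp.span (relation_words n F) \<Longrightarrow> ?r g \<in> ncp.span S"
    using relations_spanning_set[OF n k nk F sp, of N] by blast
  have r: "?r x = x" if "x \<in> ncp.span ?W" for x
    using that normal_below_subset[of n k N]
    by (intro poly_mapping_eqI) (auto simp: span_ncmonom in_keys_iff)
  have r_eq: "?r y = ?r x" if "?r (y - x) = 0" for x y
    using ncpp.linear_diff[OF linear_restrict_words[of "words_below n N"], of y x] that by simp
  have card: "card (ncmonom ` A :: 'k ncpoly set) = card A" for A
    using inj_ncmonom by (intro card_image inj_on_subset[OF inj_ncmonom]) simp
  show ?thesis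
  proof (rule disjoint_spans[of ?W S "ncmonom ` words_below n N"])
    show "finite ?W" "finite S" using S by simp_all
    show "ncp.independent (ncmonom ` words_below n N :: 'k ncpoly set)"
      by (rule independent_ncmonom)
    show "card ?W + card S \<le> card (ncmonom ` words_below n N :: 'k ncpoly set)"
      using S(2) by (simp add: card)
    show "h \<in> ncp.span ?W" by (rule h)
    show "h \<in> ncp.span S"
      using Sspan[OF g] r_eq[OF eq] r[OF h] by simp
    show "ncmonom ` words_below n N \<subseteq> ncp.span (?W \<union> S)"
    proof (rule image_subsetI)
      fix s assume s: "s \<in> words_below n N"
      then obtain h' g' where h': "h' \<in> ncp.span ?W" and g': "g' \<in> ncp.span (relation_words n F)"
        and eq': "?r (ncmonom s - h' - g') = 0"
        using sp[of N] unfolding normal_spanning_def by blast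
      have "?r (ncmonom s) = ?r (h' + g')"
        using r_eq[of "ncmonom s" "h' + g'"] eq' by (simp add: algebra_simps)
      also have "\<dots> = h' + ?r g'"
        using r[OF h'] ncpp.linear_add[OF linear_restrict_words] by metis
      finally have "ncmonom s = h' + ?r g'"
        using s by (simp add: restrict_words_ncmonom)
      then show "ncmonom s \<in> ncp.span (?W \<union> S)"
        using h' Sspan[OF g'] unfolding ncp.span_Un by blast
    qed
  qed
qed

subsection \<open>The completed potential algebra\<close>

lemma ideal_completed_ideal:
  fixes F :: "'k::field ncpoly"
  assumes F: "Poly_Mapping.keys F \<subseteq> words n"
  shows "ideal (completed_ideal n F) (free_algebra n)"
proof -
  interpret R: ring "free_algebra n :: 'k ncpoly ring" by (rule ring_free_algebra)
  have I: "ideal (potential_ideal n F) (free_algebra n)"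
    using potential_ideal_eq_span[OF F] by simp
  have D: "ideal (degree_ideal n j :: 'k ncpoly set) (free_algebra n)" for j
    unfolding degree_ideal_def
    by (rule R.genideal_ideal) (auto simp: free_algebra_def keys_ncmonom)
  show ?thesis
    unfolding completed_ideal_def
    by (rule R.i_Intersect) (use R.add_ideals[OF I D] in auto)
qed

text \<open>Turns the completion into truncations. The ideal \<open>degree_ideal n j\<close>
  consists of words longer than \<open>j\<close>, so it matches truncation at \<open>Suc j\<close>;
  the extra case \<open>N = 0\<close> is vacuous.\<close>

lemma mem_completed_ideal_iff:
  fixes F a :: "'k::field ncpoly"
  assumes F: "Poly_Mapping.keys F \<subseteq> words n" and a: "Poly_Mapping.keys a \<subseteq> words n"
  shows "a \<in> completed_ideal n F \<longleftrightarrow>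
    (\<forall>N. \<exists>g\<in>ncp.span (relation_words n F). restrict_words (words_below n N) (a - g) = 0)"
proof -
  note I = potential_ideal_eq_span[OF F]
  have plus: "x \<oplus>\<^bsub>free_algebra n\<^esub> y = x + y" for x y :: "'k ncpoly"
    by (simp add: free_algebra_def)
  have mem: "a \<in> completed_ideal n F \<longleftrightarrow>
      (\<forall>j. \<exists>g\<in>ncp.span (relation_words n F). a - g \<in> degree_ideal n j)"
  proof -
    have "a = g + d \<longleftrightarrow> d = a - g" for g d by (auto simp: algebra_simps)
    then show ?thesis
      by (simp add: completed_ideal_def set_add_def' plus I(2))
  qed
  have degree: "a - g \<in> degree_ideal n j \<longleftrightarrow> restrict_words (words_below n (Suc j)) (a - g) = 0"
    if g: "g \<in> ncp.span (relation_words n F)" for g j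
  proof -
    have "Poly_Mapping.keys g \<subseteq> words n"
      using additive_subgroup.a_subset[OF ideal.axioms(1)[OF I(1)]] g by (auto simp: free_algebra_def)
    then have "a - g \<in> ncp.span (ncmonom ` words n)"
      using a by (intro ncp.span_diff keys_subset_imp_span)
    then have "Poly_Mapping.keys (a - g) \<subseteq> words n" by (simp add: span_ncmonom)
    then show ?thesis
      unfolding degree_ideal_eq restrict_words_eq_0_iff words_below_def by auto
  qed
  have zero: "restrict_words (words_below n 0) f = 0" for f :: "'k ncpoly"
    by (simp add: restrict_words_eq_0_iff)
  show ?thesis
    unfolding mem
  proof (intro iffI allI)
    fix N assume *: "\<forall>j. \<exists>g\<in>ncp.span (relation_words n F). a - g \<in> degree_ideal n j"
    show "\<exists>g\<in>ncp.span (relation_words n F). restrict_words (words_below n N) (a - g) = 0"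
    proof (cases N)
      case 0
      then show ?thesis using zero ncp.span_zero by blast
    next
      case (Suc j)
      then show ?thesis using * degree by blast
    qed
  qed (use degree in blast)
qed

text \<open>For each \<open>N\<close>, \<open>a\<close> is a normal combination \<open>h\<close>
  plus an ideal element up to high degree. Prepending 1 keeps the words of \<open>h\<close> normal
  and distinct, so independence gives \<open>h = 0\<close>.\<close>

lemma letter_mult_completed_ideal:
  fixes F a :: "'k::field ncpoly"
  assumes n: "n \<ge> 2" and k: "k \<ge> 3" and nk: "(n, k) \<noteq> (2, 3)"
    and F: "F \<in> potential_space n k m" and sp: "\<And>N. normal_spanning n k F N"
    and a: "Poly_Mapping.keys a \<subseteq> words n" and xa: "ncmonom [1] * a \<in> completed_ideal n F"
  shows "a \<in> completed_ideal n F"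
proof -
  let ?I = "ncp.span (relation_words n F)"
  have keysF: "Poly_Mapping.keys F \<subseteq> words n" using keys_potential[OF F] by blast
  interpret I: ideal ?I "free_algebra n :: 'k ncpoly ring"
    by (rule potential_ideal_eq_span(1)[OF keysF])
  have letter: "1 \<in> {1..n}" using n by simp
  have keys_xa: "Poly_Mapping.keys (ncmonom [1] * a) \<subseteq> words n"
    using keys_mult[of "ncmonom [1]" a] a n by (fastforce simp: keys_ncmonom plus_list_def)
  show ?thesis
    unfolding mem_completed_ideal_iff[OF keysF a]
  proof
    fix N
    obtain h g where h: "h \<in> ncp.span (ncmonom ` normal_below n k N)" and g: "g \<in> ?I"
      and z: "restrict_words (words_below n N) (a - h - g) = 0"
      by (rule normal_spanning_keys[OF sp a])
    obtain g' where g': "g' \<in> ?I"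
      and z': "restrict_words (words_below n (Suc N)) (ncmonom [1] * a - g') = 0"
      using xa unfolding mem_completed_ideal_iff[OF keysF keys_xa] by blast
    have "ncmonom [1] * g \<in> ?I"
      using I.I_l_closed[OF g, of "ncmonom [1]"] n by (simp add: free_algebra_def keys_ncmonom)
    with g' have gI: "g' - ncmonom [1] * g \<in> ?I" by (rule ncp.span_diff)
    have hN: "ncmonom [1] * h \<in> ncp.span (ncmonom ` normal_below n k (Suc N))"
      by (rule linear_in_span[OF linear_mult_left h])
        (auto simp: ncmonom_mult normal_below_def normal_words_Cons_1[OF n, simplified]
          intro!: ncp.span_base)
    \<comment> \<open>Multiplication by \<open>x\<^sub>1\<close> turns the congruence for
      \<open>a\<close> below length \<open>N\<close> into one below \<open>Suc N\<close>, where it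
      is compared with the one for \<open>g'\<close>.\<close>
    have "restrict_words (words_below n (Suc N))
        (ncmonom [1] * h - (g' - ncmonom [1] * g)) = 0"
    proof -
      have "ncmonom [1] * h - (g' - ncmonom [1] * g) =
          (ncmonom [1] * a - g') - ncmonom [1] * (a - h - g)"
        by (simp add: algebra_simps)
      then show ?thesis
        using z' restrict_words_letter_mult[OF letter, of N "a - h - g"] z
        by (simp only: ncpp.linear_diff[OF linear_restrict_words]) simp
    qed
    with n k nk F sp hN gI have "ncmonom [1] * h = 0"
      by (rule normal_words_independent)
    then have "Poly_Mapping.lookup (ncmonom [1] * h) (1 # w) = 0" for w by simp
    then have "h = 0" by (intro poly_mapping_eqI) (simp add: lookup_ncmonom_mult)
    then show "\<exists>g\<in>?I. restrict_words (words_below n N) (a - g) = 0"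
      using g z by auto
  qed
qed

section \<open>Injectivity of left multiplication for generic potentials\<close>

theorem lemma1p2:
  fixes n k m :: nat
  assumes "n \<ge> 2" and "m \<ge> k" and "k \<ge> 3" and "(n, k) \<noteq> (2, 3)"
  shows "generically (potential_space n k m :: 'k::field ncpoly set)
    (\<lambda>F. \<forall>a \<in> carrier (completed_potential_algebra n F).
        a \<noteq> \<zero>\<^bsub>completed_potential_algebra n F\<^esub> \<longrightarrow>
        var_class n F 1 \<otimes>\<^bsub>completed_potential_algebra n F\<^esub> a
          \<noteq> \<zero>\<^bsub>completed_potential_algebra n F\<^esub>)"
proof -
  note n = assms(1) and m = assms(2) and k = assms(3) and nk = assms(4)
  let ?F = "special_potential n k :: 'k ncpoly"
  \<comment> \<open>One polynomial per length bound \<open>N\<close> keeps the family countable;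
    none of them vanishes at the special potential, so each zero set is proper.\<close>
  have "\<exists>p. coeff_polynomial_function p \<and> p ?F \<noteq> 0 \<and>
    (\<forall>F. p F \<noteq> 0 \<longrightarrow> normal_spanning n k F N)" for N
    unfolding normal_spanning_def
  proof (rule spanning_modulo_relations_generic)
    fix s assume s: "s \<in> words_below n N"
    have "{w \<in> normal_words n k. length w = length s} \<subseteq> normal_below n k N"
      using s by (auto simp: normal_below_def words_below_def)
    then have "ncp.span (ncmonom ` {w \<in> normal_words n k. length w = length s} \<union> relation_words n ?F)
        \<subseteq> ncp.span (ncmonom ` normal_below n k N \<union> relation_words n ?F)"
      by (intro ncp.span_mono Un_mono image_mono) auto
    then show "ncmonom s \<in> ncp.span (ncmonom ` normal_below n k N \<union> relation_words n ?F)"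
      using special_potential_spanning[OF n k, of s] s by (auto simp: words_below_def)
  qed (simp_all add: normal_below_subset)
  then obtain p where p: "\<And>N. coeff_polynomial_function (p N)" "\<And>N. p N ?F \<noteq> 0"
    and psp: "\<And>N F. p N F \<noteq> 0 \<Longrightarrow> normal_spanning n k F N"
    by metis
  show ?thesis
    unfolding generically_def
  proof (intro exI[of _ "range p"] conjI ballI impI)
    show "countable (range p)" by simp
  next
    fix q assume "q \<in> range p"
    then obtain N where q: "q = p N" by blast
    show "coeff_polynomial_function q" using p(1) q by simp
    show "\<exists>F\<in>potential_space n k m. q F \<noteq> 0"
      using p(2) special_potential_in[OF n k m] q by blast
  next
    fix F :: "'k ncpoly" and a
    let ?A = "completed_potential_algebra n F" and ?J = "completed_ideal n F"
    let ?R = "free_algebra n :: 'k ncpoly ring"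
    assume "F \<in> potential_space n k m - (\<Union>q\<in>range p. {F \<in> potential_space n k m. q F = 0})"
      and a: "a \<in> carrier ?A" "a \<noteq> \<zero>\<^bsub>?A\<^esub>"
    then have F: "F \<in> potential_space n k m" and sp: "\<And>N. normal_spanning n k F N"
      using psp by auto
    have keysF: "Poly_Mapping.keys F \<subseteq> words n" using keys_potential[OF F] by blast
    interpret J: ideal ?J ?R by (rule ideal_completed_ideal[OF keysF])
    from a(1) obtain f where f: "f \<in> carrier ?R" and af: "a = ?J +>\<^bsub>?R\<^esub> f"
      by (auto simp: completed_potential_algebra_def FactRing_def A_RCOSETS_def')
    have x: "ncmonom [1] \<in> carrier ?R"
      using n by (simp add: free_algebra_def keys_ncmonom)
    show "var_class n F 1 \<otimes>\<^bsub>?A\<^esub> a \<noteq> \<zero>\<^bsub>?A\<^esub>"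
    proof
      assume "var_class n F 1 \<otimes>\<^bsub>?A\<^esub> a = \<zero>\<^bsub>?A\<^esub>"
      \<comment> \<open>A vanishing product of cosets means that \<open>x\<^sub>1\<close> times the
        representative \<open>f\<close> lies in the completed ideal.\<close>
      then have "?J +>\<^bsub>?R\<^esub> (ncmonom [1] \<otimes>\<^bsub>?R\<^esub> f) = ?J"
        using J.rcoset_mult_add[OF x f]
        by (simp add: completed_potential_algebra_def FactRing_def var_class_def af)
      then have "ncmonom [1] * f \<in> ?J"
        using J.rcos_const_imp_mem[OF J.m_closed[OF x f]] by (simp add: free_algebra_def)
      then have "f \<in> ?J"
        by (rule letter_mult_completed_ideal[OF n k nk F sp, rotated])
          (use f in \<open>simp add: free_algebra_def\<close>)
      then have "a = ?J"
        unfolding af by (rule J.a_rcos_const)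
      then show False
        using a(2) by (simp add: completed_potential_algebra_def FactRing_def)
    qed
  qed
qed

end
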